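(* Let $\ell$ be an irrecoverable positive definite binary $\mathbb{Z}$-lattice with $\mathfrak{n}\ell=s\mathbb{Z}$ ($s$ a positive integer) and $D_\ell=s^2D$, and let $L$ be an isolation of $\ell$. Then for every prime $p$ such that $\left(\frac{D}{p}\right)=1$ and $p\in Q(\mathcal{D})$ for some ambiguous class $\mathcal{D}\in\mathfrak{S}_D$, the lattice $L$ has a primitive binary sublattice $M$ with $\mathfrak{n}M\subseteq p\mathbb{Z}$.
   Context: A $\mathbb{Z}$-lattice is a free $\mathbb{Z}$-module with a positive definite symmetric bilinear form $B$ (rational values), $Q(x)=B(x,x)$; $\mathfrak{s}L$ (scale) and $\mathfrak{n}L$ (norm) are the $\mathbb{Z}$-modules generated by $\{B(x,y)\}$ and $\{Q(x)\}$ respectively. For a binary lattice with Gram matrix $\begin{pmatrix} a & b/2\\ b/2 & c\end{pmatrix}$, $D_\ell=b^2-4ac$. A lattice $K$ is represented by $L$ if there is a $\mathbb{Z}$-linear map $\sigma:K\to L$ with $B(\sigma x,\sigma y)=B(x,y)$. A proper sublattice of $\ell$ is a sublattice of the same rank and index $>1$. An isolation of $\ell$ is a $\mathbb{Z}$-lattice $L$ with $\mathfrak{s}L\subseteq\mathbb{Z}$ which represents every proper sublattice of $\ell$ but does not represent $\ell$; $\ell$ is irrecoverable if it has an isolation. A sublattice $M\subseteq L$ is primitive if $M=\mathbb{Q}M\cap L$. $\mathfrak{S}_D$ is the form class group of proper equivalence classes of positive definite forms $ax^2+bxy+cy^2$ with $\gcd(a,b,c)=1$, $b^2-4ac=D$,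 under Gauss composition with identity $\mathcal{E}$; a class $\mathcal{D}$ is ambiguous if $\mathcal{D}^2=\mathcal{E}$; $Q(\mathcal{D})$ is the set of integers represented by forms in $\mathcal{D}$. $\left(\frac{D}{p}\right)$ is the Kronecker symbol. *)

theory Defs
  imports
    "HOL-Algebra.Group"
    "HOL-Number_Theory.Residues"
    "HOL-Computational_Algebra.Group_Closure"
    "HOL-Library.Poly_Mapping"
begin

section \<open>Positive definite lattices\<close>

text \<open>
  A lattice \<open>pts L\<close> is given inside an ambient rational vector space, namely the type \<open>'a\<close>
  with scalar multiplication \<open>smul L\<close>, and its form \<open>bil L\<close> is a form on that space. Every free
  module of finite rank with a rational-valued form is of this shape (take the tensor product
  with the rationals). The ambient space may be larger than the span of the lattice.
\<close>

record 'a zlat =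
  smul :: "rat \<Rightarrow> 'a \<Rightarrow> 'a"
  bil :: "'a \<Rightarrow> 'a \<Rightarrow> rat"
  pts :: "'a set"

definition zbasis :: "('a::ab_group_add) zlat \<Rightarrow> 'a set \<Rightarrow> bool" where
  "zbasis L bs \<longleftrightarrow> finite bs \<and> \<not> module.dependent (smul L) bs \<and> pts L = group_closure bs"

definition is_zlattice :: "('a::ab_group_add) zlat \<Rightarrow> bool" where
  "is_zlattice L \<longleftrightarrow>
     vector_space (smul L) \<and>
     (\<forall>x. Vector_Spaces.linear (smul L) (*) (bil L x)) \<and>
     (\<forall>x y. bil L x y = bil L y x) \<and>
     (\<exists>bs. zbasis L bs) \<and>
     (\<forall>x\<in>pts L. x \<noteq> 0 \<longrightarrow> bil L x x > 0)"

definition lat_rank :: "('a::ab_group_add) zlat \<Rightarrow> nat" where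
  "lat_rank L = vector_space.dim (smul L) (pts L)"

definition scale_ideal :: "('a::ab_group_add) zlat \<Rightarrow> rat set" where
  "scale_ideal L = group_closure {bil L x y | x y. x \<in> pts L \<and> y \<in> pts L}"

definition norm_ideal :: "('a::ab_group_add) zlat \<Rightarrow> rat set" where
  "norm_ideal L = group_closure {bil L x x | x. x \<in> pts L}"

definition int_multiples :: "int \<Rightarrow> rat set" where
  "int_multiples m = {of_int (m * k) | k. True}"

text \<open>
  The discriminant \<open>b\<^sup>2 - 4 a c\<close> of a binary lattice, where \<open>a = Q x\<close>, \<open>b = 2 B(x, y)\<close> and
  \<open>c = Q y\<close> for a basis \<open>x, y\<close>; see \<open>lat_disc_eq\<close> for the independence of the basis.
\<close>

definition lat_disc :: "('a::ab_group_add) zlat \<Rightarrow> rat" where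
  "lat_disc L = (THE d. \<exists>x y. x \<noteq> y \<and> zbasis L {x, y} \<and>
     d = (2 * bil L x y)\<^sup>2 - 4 * bil L x x * bil L y y)"

definition represents :: "('b::ab_group_add) zlat \<Rightarrow> ('a::ab_group_add) zlat \<Rightarrow> bool" where
  "represents L K \<longleftrightarrow> (\<exists>\<sigma>.
     (\<forall>x\<in>pts K. \<sigma> x \<in> pts L) \<and>
     (\<forall>x\<in>pts K. \<forall>y\<in>pts K. \<sigma> (x + y) = \<sigma> x + \<sigma> y) \<and>
     (\<forall>x\<in>pts K. \<forall>y\<in>pts K. bil L (\<sigma> x) (\<sigma> y) = bil K x y))"

definition sublattice :: "('a::ab_group_add) zlat \<Rightarrow> 'a zlat \<Rightarrow> bool" where
  "sublattice K L \<longleftrightarrow>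
     is_zlattice K \<and> smul K = smul L \<and> bil K = bil L \<and> pts K \<subseteq> pts L"

text \<open>
  The number of cosets. It is only used for sublattices of full rank, where it is finite, so
  that the convention on the cardinality of infinite sets plays no role.
\<close>

definition lat_index :: "('a::ab_group_add) zlat \<Rightarrow> 'a zlat \<Rightarrow> nat" where
  "lat_index L K = card ((\<lambda>x. (+) x ` pts K) ` pts L)"

definition proper_sublattice :: "('a::ab_group_add) zlat \<Rightarrow> 'a zlat \<Rightarrow> bool" where
  "proper_sublattice K L \<longleftrightarrow>
     sublattice K L \<and> lat_rank K = lat_rank L \<and> lat_index L K > 1"

definition primitive_sublattice :: "('a::ab_group_add) zlat \<Rightarrow> 'a zlat \<Rightarrow> bool" where
  "primitive_sublattice M L \<longleftrightarrow>
     sublattice M L \<and> pts M = module.span (smul L) (pts M) \<inter> pts L"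

definition isolation :: "('b::ab_group_add) zlat \<Rightarrow> ('a::ab_group_add) zlat \<Rightarrow> bool" where
  "isolation L l \<longleftrightarrow>
     is_zlattice L \<and> scale_ideal L \<subseteq> \<int> \<and>
     (\<forall>K. proper_sublattice K l \<longrightarrow> represents L K) \<and>
     \<not> represents L l"

text \<open>
  A quantifier cannot range over all types; but every lattice is isometric to one in the space
  \<open>nat \<Rightarrow>\<^sub>0 rat\<close> of countably infinite dimension, so nothing is lost by looking for isolations
  there (\<open>isolation_imp_irrecoverable\<close>).
\<close>

definition irrecoverable :: "('a::ab_group_add) zlat \<Rightarrow> bool" where
  "irrecoverable l \<longleftrightarrow> (\<exists>L :: (nat \<Rightarrow>\<^sub>0 rat) zlat. isolation L l)"


section \<open>The form class group\<close>

text \<open>The triple \<open>(a, b, c)\<close> stands for the form \<open>a x\<^sup>2 + b x y + c y\<^sup>2\<close>.\<close>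

type_synonym bqf = "int \<times> int \<times> int"

fun bqf_eval :: "bqf \<Rightarrow> int \<Rightarrow> int \<Rightarrow> int" where
  "bqf_eval (a, b, c) x y = a * x\<^sup>2 + b * x * y + c * y\<^sup>2"

definition prim_forms :: "int \<Rightarrow> bqf set" where
  "prim_forms D = {(a, b, c). gcd a (gcd b c) = 1 \<and> b\<^sup>2 - 4 * a * c = D \<and>
     (\<forall>x y. (x, y) \<noteq> (0, 0) \<longrightarrow> bqf_eval (a, b, c) x y > 0)}"

definition properly_equivalent :: "bqf \<Rightarrow> bqf \<Rightarrow> bool" where
  "properly_equivalent f g \<longleftrightarrow> (\<exists>\<alpha> \<beta> \<gamma> \<delta>. \<alpha> * \<delta> - \<beta> * \<gamma> = 1 \<and>
     (\<forall>x y. bqf_eval f x y = bqf_eval g (\<alpha> * x + \<beta> * y) (\<gamma> * x + \<delta> * y)))"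

definition proper_equiv :: "int \<Rightarrow> (bqf \<times> bqf) set" where
  "proper_equiv D =
     {(f, g). f \<in> prim_forms D \<and> g \<in> prim_forms D \<and> properly_equivalent f g}"

text \<open>
  Gauss's direct composition: \<open>f(x, y) g(z, w) = F(X, Y)\<close> for integral bilinear
  \<open>X, Y\<close>, where the two conditions on the minors fix the orientation.
\<close>

definition direct_composition :: "bqf \<Rightarrow> bqf \<Rightarrow> bqf \<Rightarrow> bool" where
  "direct_composition f g F \<longleftrightarrow> (\<exists>a1 b1 c1 d1 a2 b2 c2 d2.
     (\<forall>x y z w. bqf_eval f x y * bqf_eval g z w =
        bqf_eval F (a1 * x * z + b1 * x * w + c1 * y * z + d1 * y * w)
                   (a2 * x * z + b2 * x * w + c2 * y * z + d2 * y * w)) \<and>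
     a1 * b2 - a2 * b1 = bqf_eval f 1 0 \<and>
     a1 * c2 - a2 * c1 = bqf_eval g 1 0)"

text \<open>
  The product of two classes consists of all forms of discriminant \<open>D\<close> that are directly
  composed of members of the two classes; by Gauss these form a single class. The principal
  form is \<open>x\<^sup>2 - (D/4) y\<^sup>2\<close> or \<open>x\<^sup>2 + x y + ((1 - D)/4) y\<^sup>2\<close>, depending on the parity of \<open>D\<close>.
\<close>

definition principal_form :: "int \<Rightarrow> bqf" where
  "principal_form D = (1, D mod 2, (D mod 2 - D) div 4)"

definition form_class_group :: "int \<Rightarrow> bqf set monoid" where
  "form_class_group D =
     \<lparr>carrier = prim_forms D // proper_equiv D,
      monoid.mult = (\<lambda>C C'. {F \<in> prim_forms D. \<exists>f\<in>C. \<exists>g\<in>C'. direct_composition f g F}),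
      one = proper_equiv D `` {principal_form D}\<rparr>"

definition ambiguous :: "int \<Rightarrow> bqf set \<Rightarrow> bool" where
  "ambiguous D C \<longleftrightarrow> C \<otimes>\<^bsub>form_class_group D\<^esub> C = \<one>\<^bsub>form_class_group D\<^esub>"

definition represented_ints :: "bqf set \<Rightarrow> int set" where
  "represented_ints C = {bqf_eval f x y | f x y. f \<in> C}"

text \<open>The Kronecker symbol, for a prime as its lower argument.\<close>

definition kronecker :: "int \<Rightarrow> int \<Rightarrow> int" where
  "kronecker D p =
     (if p = 2 then (if even D then 0 else if D mod 8 \<in> {1, 7} then 1 else -1)
      else Legendre D p)"


section \<open>Well-definedness\<close>

lemma equiv_proper_equiv: "equiv (prim_forms D) (proper_equiv D)"
proof (rule equivI)
  show "proper_equiv D \<subseteq> prim_forms D \<times> prim_forms D"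
    by (auto simp: proper_equiv_def)
  show "refl_on (prim_forms D) (proper_equiv D)"
  proof (rule refl_onI)
    fix f assume "f \<in> prim_forms D"
    moreover have "(1::int) * 1 - 0 * 0 = 1 \<and>
      (\<forall>x y. bqf_eval f x y = bqf_eval f (1 * x + 0 * y) (0 * x + 1 * y))" by simp
    ultimately show "(f, f) \<in> proper_equiv D"
      unfolding proper_equiv_def properly_equivalent_def by blast
  qed
  show "sym (proper_equiv D)"
  proof (rule symI)
    fix f g assume fg: "(f, g) \<in> proper_equiv D"
    then obtain \<alpha> \<beta> \<gamma> \<delta> where det: "\<alpha> * \<delta> - \<beta> * \<gamma> = 1"
      and e: "\<And>x y. bqf_eval f x y = bqf_eval g (\<alpha> * x + \<beta> * y) (\<gamma> * x + \<delta> * y)"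
      unfolding proper_equiv_def properly_equivalent_def by blast
    have "bqf_eval g x y = bqf_eval f (\<delta> * x + (-\<beta>) * y) ((-\<gamma>) * x + \<alpha> * y)" for x y
    proof -
      have "\<alpha> * (\<delta> * x + (-\<beta>) * y) + \<beta> * ((-\<gamma>) * x + \<alpha> * y) = (\<alpha> * \<delta> - \<beta> * \<gamma>) * x"
        "\<gamma> * (\<delta> * x + (-\<beta>) * y) + \<delta> * ((-\<gamma>) * x + \<alpha> * y) = (\<alpha> * \<delta> - \<beta> * \<gamma>) * y"
        by (simp_all add: algebra_simps)
      then show ?thesis by (simp only: e det mult_1_left)
    qed
    moreover have "\<delta> * \<alpha> - (-\<beta>) * (-\<gamma>) = 1" using det by (simp add: algebra_simps)
    ultimately show "(g, f) \<in> proper_equiv D"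
      using fg unfolding proper_equiv_def properly_equivalent_def by blast
  qed
  show "trans (proper_equiv D)"
  proof (rule transI)
    fix f g h assume fg: "(f, g) \<in> proper_equiv D" and gh: "(g, h) \<in> proper_equiv D"
    obtain \<alpha> \<beta> \<gamma> \<delta> where det: "\<alpha> * \<delta> - \<beta> * \<gamma> = 1"
      and e: "\<And>x y. bqf_eval f x y = bqf_eval g (\<alpha> * x + \<beta> * y) (\<gamma> * x + \<delta> * y)"
      using fg unfolding proper_equiv_def properly_equivalent_def by blast
    obtain \<alpha>' \<beta>' \<gamma>' \<delta>' where det': "\<alpha>' * \<delta>' - \<beta>' * \<gamma>' = 1"
      and e': "\<And>x y. bqf_eval g x y = bqf_eval h (\<alpha>' * x + \<beta>' * y) (\<gamma>' * x + \<delta>' * y)"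
      using gh unfolding proper_equiv_def properly_equivalent_def by blast
    have "bqf_eval f x y = bqf_eval h
        ((\<alpha>' * \<alpha> + \<beta>' * \<gamma>) * x + (\<alpha>' * \<beta> + \<beta>' * \<delta>) * y)
        ((\<gamma>' * \<alpha> + \<delta>' * \<gamma>) * x + (\<gamma>' * \<beta> + \<delta>' * \<delta>) * y)" for x y
      by (simp add: e e' algebra_simps)
    moreover have "(\<alpha>' * \<alpha> + \<beta>' * \<gamma>) * (\<gamma>' * \<beta> + \<delta>' * \<delta>) -
        (\<alpha>' * \<beta> + \<beta>' * \<delta>) * (\<gamma>' * \<alpha> + \<delta>' * \<gamma>) = (\<alpha>' * \<delta>' - \<beta>' * \<gamma>') * (\<alpha> * \<delta> - \<beta> * \<gamma>)"
      by (simp add: algebra_simps)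
    then have "(\<alpha>' * \<alpha> + \<beta>' * \<gamma>) * (\<gamma>' * \<beta> + \<delta>' * \<delta>) -
        (\<alpha>' * \<beta> + \<beta>' * \<delta>) * (\<gamma>' * \<alpha> + \<delta>' * \<gamma>) = 1" by (simp only: det det' mult_1_left)
    ultimately have "properly_equivalent f h" unfolding properly_equivalent_def by blast
    then show "(f, h) \<in> proper_equiv D" using fg gh by (simp add: proper_equiv_def)
  qed
qed

lemma group_closure_pair:
  assumes "vector_space sc" and "u \<in> group_closure {x, y}"
  shows "\<exists>m n. u = sc (of_int m) x + sc (of_int n) y"
  using assms(2)
proof induction
  case (base s)
  interpret vector_space sc by fact
  from base consider "s = 0" | "s = x" | "s = y" by blast
  then show ?case
  proof cases
    case 1 then show ?thesis by (intro exI[of _ 0]) simp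
  next
    case 2 then show ?thesis by (intro exI[of _ 1] exI[of _ 0]) simp
  next
    case 3 then show ?thesis by (intro exI[of _ 1] exI[of _ 0]) simp
  qed
next
  case (diff s t)
  interpret vector_space sc by fact
  obtain m n m' n' where "s = sc (of_int m) x + sc (of_int n) y"
    "t = sc (of_int m') x + sc (of_int n') y" using diff.IH by blast
  then have "s - t = sc (of_int (m - m')) x + sc (of_int (n - n')) y"
    by (simp add: scale_left_diff_distrib algebra_simps)
  then show ?case by blast
qed

lemma lat_disc_change:
  assumes L: "is_zlattice L" and "u \<in> group_closure {x, y}" "v \<in> group_closure {x, y}"
  shows "\<exists>k::int. (2 * bil L u v)\<^sup>2 - 4 * bil L u u * bil L v v =
    of_int k ^ 2 * ((2 * bil L x y)\<^sup>2 - 4 * bil L x x * bil L y y)"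
proof -
  have vs: "vector_space (smul L)" using L by (simp add: is_zlattice_def)
  have lin: "\<And>x. Vector_Spaces.linear (smul L) (*) (bil L x)"
    and sym: "\<And>x y. bil L x y = bil L y x" using L by (auto simp: is_zlattice_def)
  have addr: "bil L z (a + b) = bil L z a + bil L z b"
    and scr: "bil L z (smul L c a) = c * bil L z a" for z a b c
    using lin[of z] by (simp_all add: Vector_Spaces.linear_iff)
  have addl: "bil L (a + b) z = bil L a z + bil L b z"
    and scl: "bil L (smul L c a) z = c * bil L a z" for z a b c
    using addr scr sym by metis+
  obtain m n m' n' where
    uv: "u = smul L (of_int m) x + smul L (of_int n) y" "v = smul L (of_int m') x + smul L (of_int n') y"
    using group_closure_pair[OF vs] assms(2,3) by meson
  show ?thesis
    unfolding uv addr addl scr scl sym[of y x]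
    by (intro exI[of _ "m * n' - n * m'"])
       (simp add: algebra_simps power2_eq_square)
qed

lemma lat_disc_eq:
  assumes L: "is_zlattice L" and xy: "x \<noteq> y" "zbasis L {x, y}"
  shows "lat_disc L = (2 * bil L x y)\<^sup>2 - 4 * bil L x x * bil L y y"
  unfolding lat_disc_def
proof (rule the_equality)
  show "\<exists>x' y'. x' \<noteq> y' \<and> zbasis L {x', y'} \<and>
     (2 * bil L x y)\<^sup>2 - 4 * bil L x x * bil L y y =
     (2 * bil L x' y')\<^sup>2 - 4 * bil L x' x' * bil L y' y'"
    using xy by blast
next
  fix d
  assume "\<exists>x y. x \<noteq> y \<and> zbasis L {x, y} \<and> d = (2 * bil L x y)\<^sup>2 - 4 * bil L x x * bil L y y"
  then obtain u v where uv: "zbasis L {u, v}"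
    and d: "d = (2 * bil L u v)\<^sup>2 - 4 * bil L u u * bil L v v" by blast
  define e where "e = (2 * bil L x y)\<^sup>2 - 4 * bil L x x * bil L y y"
  have "group_closure {u, v} = group_closure {x, y}"
    using xy(2) uv by (simp add: zbasis_def)
  moreover have "a \<in> group_closure {a, b}" "b \<in> group_closure {a, b}" for a b :: 'a
    by (auto intro: group_closure.base)
  ultimately have mem: "u \<in> group_closure {x, y}" "v \<in> group_closure {x, y}"
    "x \<in> group_closure {u, v}" "y \<in> group_closure {u, v}"
    by metis+
  obtain k where k: "d = of_int k ^ 2 * e"
    using lat_disc_change[OF L mem(1,2)] unfolding d e_def by blast
  obtain k' where k': "e = of_int k' ^ 2 * d"
    using lat_disc_change[OF L mem(3,4)] unfolding d e_def by blast
  show "d = (2 * bil L x y)\<^sup>2 - 4 * bil L x x * bil L y y"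
  proof (cases "e = 0")
    case True then show ?thesis using k unfolding e_def by simp
  next
    case False
    have "e = of_int ((k' * k)\<^sup>2) * e" using k k' by (simp add: power_mult_distrib mult.assoc)
    then have "(of_int ((k' * k)\<^sup>2) :: rat) = 1" using False by simp
    then have "(k' * k)\<^sup>2 = 1" by linarith
    moreover have "k dvd (k' * k)\<^sup>2" by (simp add: power2_eq_square)
    ultimately have "\<bar>k\<bar> = 1" by simp
    then have "k\<^sup>2 = 1" by (auto simp: abs_if split: if_splits)
    then have "(of_int k :: rat) ^ 2 = 1" by (metis of_int_1 of_int_power)
    then show ?thesis using k unfolding e_def by simp
  qed
qed

lemma isolation_imp_irrecoverable:
  fixes L :: "('b::ab_group_add) zlat" and l :: "('a::ab_group_add) zlat"
  assumes iso: "isolation L l"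
  shows "irrecoverable l"
proof -
  have L: "is_zlattice L" using iso by (simp add: isolation_def)
  interpret V: vector_space "smul L" using L by (simp add: is_zlattice_def)
  obtain bs where bs: "finite bs" "V.independent bs" "pts L = group_closure bs"
    using L by (auto simp: is_zlattice_def zbasis_def)
  obtain f :: "'b \<Rightarrow> nat" where f: "inj_on f bs"
    using finite_imp_inj_to_nat_seg[OF bs(1)] by metis
  define sc :: "rat \<Rightarrow> (nat \<Rightarrow>\<^sub>0 rat) \<Rightarrow> nat \<Rightarrow>\<^sub>0 rat" where "sc c = Poly_Mapping.map ((*) c)" for c
  have lsc: "Poly_Mapping.lookup (sc c p) k = c * Poly_Mapping.lookup p k" for c p k
    unfolding sc_def by transfer (simp add: when_def)
  have vsc: "vector_space sc"
    by unfold_locales (auto intro!: poly_mapping_eqI simp: lsc lookup_add algebra_simps)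
  interpret W: vector_space sc by (rule vsc)
  define \<psi> where "\<psi> p = (\<Sum>b\<in>bs. smul L (Poly_Mapping.lookup p (f b)) b)" for p :: "nat \<Rightarrow>\<^sub>0 rat"
  have \<psi>add: "\<psi> (p + q) = \<psi> p + \<psi> q" for p q
    by (simp add: \<psi>_def lookup_add V.scale_left_distrib sum.distrib)
  have \<psi>diff: "\<psi> (p - q) = \<psi> p - \<psi> q" for p q
    by (simp add: \<psi>_def lookup_minus V.scale_left_diff_distrib sum_subtractf)
  have \<psi>sc: "\<psi> (sc c p) = smul L c (\<psi> p)" for c p
    by (simp add: \<psi>_def lsc V.scale_sum_right)
  define E where "E = (\<lambda>b. Poly_Mapping.single (f b) (1::rat)) ` bs"
  define L' where "L' = \<lparr>smul = sc, bil = (\<lambda>p q. bil L (\<psi> p) (\<psi> q)), pts = group_closure E\<rparr>"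
  have \<psi>E: "\<psi> (Poly_Mapping.single (f b) 1) = b" if b: "b \<in> bs" for b
  proof -
    have "\<psi> (Poly_Mapping.single (f b) 1) = (\<Sum>b'\<in>bs. if b' = b then b else 0)"
      unfolding \<psi>_def
      by (rule sum.cong) (use f b in \<open>auto simp: lookup_single when_def dest: inj_onD\<close>)
    then show ?thesis using b bs(1) by simp
  qed
  have supp: "Poly_Mapping.lookup p k = 0" if "p \<in> group_closure E" "k \<notin> f ` bs" for p k
    using that(1) by induction (use that(2) in \<open>auto simp: E_def lookup_single when_def lookup_minus\<close>)
  have inj0: "p = 0" if p: "p \<in> group_closure E" and 0: "\<psi> p = 0" for p
  proof (rule poly_mapping_eqI)
    fix k
    have "Poly_Mapping.lookup p (f b) = 0" if "b \<in> bs" for b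
      using V.independentD[OF bs(2) bs(1) order_refl, of "\<lambda>b. Poly_Mapping.lookup p (f b)" b] 0 that
      by (simp add: \<psi>_def)
    then show "Poly_Mapping.lookup p k = Poly_Mapping.lookup 0 k" using supp[OF p, of k] by auto
  qed
  have inj: "inj_on \<psi> (group_closure E)"
  proof (rule inj_onI)
    fix p q assume "p \<in> group_closure E" "q \<in> group_closure E" "\<psi> p = \<psi> q"
    then have "p - q = 0" by (intro inj0) (auto intro: group_closure.diff simp: \<psi>diff)
    then show "p = q" by simp
  qed
  have into: "\<psi> p \<in> group_closure bs" if "p \<in> group_closure E" for p
    using that
  proof induction
    case (base p)
    then show ?case using \<psi>E \<psi>diff[of 0 0] by (auto simp: E_def intro: group_closure.base)
  next
    case (diff p q) then show ?case by (simp add: \<psi>diff group_closure.diff)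
  qed
  have onto: "\<exists>p\<in>group_closure E. \<psi> p = x" if "x \<in> group_closure bs" for x
    using that
  proof induction
    case (base x)
    then show ?case
    proof (cases "x = 0")
      case True then show ?thesis using \<psi>diff[of 0 0] by (intro bexI[of _ 0]) auto
    next
      case False
      then have "x \<in> bs" using base by simp
      then show ?thesis
        by (intro bexI[of _ "Poly_Mapping.single (f x) 1"]) (auto simp: \<psi>E E_def intro: group_closure.base)
    qed
  next
    case (diff x y)
    then obtain p q where "p \<in> group_closure E" "q \<in> group_closure E" "\<psi> p = x" "\<psi> q = y" by blast
    then show ?case by (intro bexI[of _ "p - q"]) (auto simp: \<psi>diff intro: group_closure.diff)
  qed
  have indepE: "W.independent E"
  proof
    assume "W.dependent E"
    then obtain u where u: "\<exists>e\<in>E. u e \<noteq> 0" "(\<Sum>e\<in>E. sc (u e) e) = 0"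
      using W.dependent_finite[of E] bs(1) by (auto simp: E_def)
    then obtain b where b: "b \<in> bs" "u (Poly_Mapping.single (f b) 1) \<noteq> 0" by (auto simp: E_def)
    have injs: "inj_on (\<lambda>b. Poly_Mapping.single (f b) (1::rat)) bs"
      by (rule inj_onI) (metis \<psi>E)
    have "0 = \<psi> (\<Sum>b\<in>bs. sc (u (Poly_Mapping.single (f b) 1)) (Poly_Mapping.single (f b) 1))"
      using u(2) \<psi>diff[of 0 0] by (simp add: E_def sum.reindex[OF injs])
    also have "\<dots> = (\<Sum>b\<in>bs. \<psi> (sc (u (Poly_Mapping.single (f b) 1)) (Poly_Mapping.single (f b) 1)))"
      by (rule sum_comp_morphism[unfolded o_def, symmetric]) (use \<psi>add \<psi>diff[of 0 0] in auto)
    also have "\<dots> = (\<Sum>b\<in>bs. smul L (u (Poly_Mapping.single (f b) 1)) b)"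
      by (simp add: \<psi>sc \<psi>E)
    finally show False
      using V.independentD[OF bs(2) bs(1) order_refl, of "\<lambda>b. u (Poly_Mapping.single (f b) 1)" b] b by simp
  qed
  have lin: "Vector_Spaces.linear (smul L) (*) (bil L x)"
    and sym: "bil L x y = bil L y x" for x y using L by (auto simp: is_zlattice_def)
  have "is_zlattice L'"
    unfolding is_zlattice_def
  proof (intro conjI allI ballI impI)
    show "vector_space (smul L')" by (simp add: L'_def vsc)
    show "Vector_Spaces.linear (smul L') (*) (bil L' p)" for p
      using lin[of "\<psi> p"] vsc by (simp add: L'_def Vector_Spaces.linear_iff \<psi>add \<psi>sc)
    show "bil L' p q = bil L' q p" for p q by (simp add: L'_def sym)
    show "\<exists>bs. zbasis L' bs"
      using indepE bs(1) by (intro exI[of _ E]) (simp add: zbasis_def L'_def E_def)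
    show "bil L' p p > 0" if "p \<in> pts L'" "p \<noteq> 0" for p
      using that L into[of p] inj0[of p] bs(3) by (auto simp: L'_def is_zlattice_def)
  qed
  moreover have "scale_ideal L' \<subseteq> \<int>"
  proof -
    have "{bil L' x y |x y. x \<in> pts L' \<and> y \<in> pts L'} \<subseteq> {bil L x y |x y. x \<in> pts L \<and> y \<in> pts L}"
      using into bs(3) by (auto simp: L'_def)
    then have "{bil L' x y |x y. x \<in> pts L' \<and> y \<in> pts L'} \<subseteq> \<int>"
      using iso unfolding isolation_def scale_ideal_def
      by (meson group_closure.base insertI2 subset_iff)
    moreover have "z \<in> \<int>" if "z \<in> group_closure S" "S \<subseteq> \<int>" for z :: rat and S
      using that(1) by induction (use that(2) in auto)
    ultimately show ?thesis unfolding scale_ideal_def by blast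
  qed
  moreover have "represents L' K" if "proper_sublattice K l" for K
  proof -
    have "represents L K" using iso that by (simp add: isolation_def)
    then obtain \<sigma> where \<sigma>: "\<forall>x\<in>pts K. \<sigma> x \<in> pts L"
      "\<forall>x\<in>pts K. \<forall>y\<in>pts K. \<sigma> (x + y) = \<sigma> x + \<sigma> y"
      "\<forall>x\<in>pts K. \<forall>y\<in>pts K. bil L (\<sigma> x) (\<sigma> y) = bil K x y" unfolding represents_def by blast
    define \<phi> where "\<phi> = inv_into (group_closure E) \<psi>"
    have \<phi>: "\<phi> x \<in> group_closure E" "\<psi> (\<phi> x) = x" if "x \<in> pts L" for x
      using onto[of x] that bs(3) unfolding \<phi>_def
      by (metis image_eqI inv_into_into, metis image_eqI f_inv_into_f)
    have \<phi>add: "\<phi> (x + y) = \<phi> x + \<phi> y" if "x \<in> pts L" "y \<in> pts L" for x y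
    proof (rule inj_onD[OF inj])
      have "x + y \<in> pts L" using that bs(3) by (simp add: group_closure_add)
      then show "\<psi> (\<phi> (x + y)) = \<psi> (\<phi> x + \<phi> y)" "\<phi> (x + y) \<in> group_closure E"
        "\<phi> x + \<phi> y \<in> group_closure E"
        using \<phi> that by (auto simp: \<psi>add intro: group_closure_add)
    qed
    show ?thesis
      unfolding represents_def
      by (rule exI[of _ "\<phi> \<circ> \<sigma>"]) (use \<sigma> \<phi> \<phi>add in \<open>simp add: L'_def\<close>)
  qed
  moreover have "\<not> represents L' l"
  proof
    assume "represents L' l"
    then obtain \<sigma> where \<sigma>: "\<forall>x\<in>pts l. \<sigma> x \<in> pts L'"
      "\<forall>x\<in>pts l. \<forall>y\<in>pts l. \<sigma> (x + y) = \<sigma> x + \<sigma> y"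
      "\<forall>x\<in>pts l. \<forall>y\<in>pts l. bil L' (\<sigma> x) (\<sigma> y) = bil l x y" unfolding represents_def by blast
    have "represents L l"
      unfolding represents_def
      by (rule exI[of _ "\<psi> \<circ> \<sigma>"]) (use \<sigma> into bs(3) in \<open>simp add: L'_def \<psi>add\<close>)
    then show False using iso by (simp add: isolation_def)
  qed
  ultimately show ?thesis unfolding irrecoverable_def isolation_def by blast
qed

end

theory Submission
  imports Defs
begin

text \<open>
  Write the form of \<open>l\<close> in a basis \<open>g, h\<close> as \<open>s (a x\<^sup>2 + b x y + c y\<^sup>2)\<close>. The sublattice spanned by
  \<open>g\<close> and \<open>p h\<close> has an image \<open>\<langle>G, H\<rangle>\<close> in \<open>L\<close>. If its saturation contains a vector whose norm is prime
  to \<open>p\<close>, then a multiple of that vector prime to \<open>p\<close> is \<open>(x G + y H) / p\<^sup>w\<close> with \<open>w \<ge> 1\<close> and \<open>x, y\<close>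
  not both divisible by \<open>p\<close>, so the value of the form at \<open>x, y\<close> has \<open>p\<close>-adic valuation exactly
  \<open>2 w\<close>. Comparing its parity with that of the valuation of \<open>s\<close> decides which of \<open>x, y\<close> is divisible
  by \<open>p\<close>.

  If the valuation of \<open>s\<close> is odd, take \<open>a\<close> prime to \<open>p\<close>; then \<open>p\<close> divides \<open>x\<close>, so \<open>H / p\<close> lies in
  \<open>L\<close>, and \<open>\<langle>G, H / p\<rangle>\<close> is a copy of \<open>l\<close>.

  If it is even, take \<open>a = p\<^sup>2 A\<close>, which is possible because \<open>p\<close> splits; then \<open>p\<close> divides \<open>x\<close> or \<open>y\<close>. In
  the second case \<open>G / p\<close> lies in \<open>L\<close>, and \<open>\<langle>G / p, H\<rangle>\<close> carries the form \<open>s (A, b, p\<^sup>2 c)\<close>.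
  Since \<open>(p\<^sup>2 A, b, c)\<close> is the composition of \<open>(p\<^sup>2, b, A c)\<close> with \<open>(A, b, p\<^sup>2 c)\<close>, and the former is
  the square of an ambiguous class, hence principal, this is again a copy of \<open>l\<close>.
\<close>

section \<open>Subgroups of a rational vector space\<close>

text \<open>The scalar field is fixed to \<open>rat\<close>, where nonzero integers can be inverted;
  facts that involve no form are collected here and reach lattices through the sublocale
  \<open>V\<close>.\<close>

locale rat_space = vector_space scale
  for scale :: "rat \<Rightarrow> 'a::ab_group_add \<Rightarrow> 'a"

locale zlattice =
  fixes L :: "('a::ab_group_add) zlat"
  assumes zlattice: "is_zlattice L"
begin

sublocale V: rat_space "smul L"
  using zlattice by (simp add: is_zlattice_def rat_space_def)

lemma bil_sym: "bil L x y = bil L y x"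
  using zlattice by (simp add: is_zlattice_def)

lemma bil_add_right: "bil L z (x + y) = bil L z x + bil L z y"
  and bil_smul_right: "bil L z (smul L c x) = c * bil L z x"
  using zlattice by (simp_all add: is_zlattice_def Vector_Spaces.linear_iff)

lemma bil_add_left: "bil L (x + y) z = bil L x z + bil L y z"
  and bil_smul_left: "bil L (smul L c x) z = c * bil L x z"
  using bil_add_right bil_smul_right bil_sym by metis+

lemmas bil_simps = bil_add_right bil_smul_right bil_add_left bil_smul_left

lemma pts_diff: "x \<in> pts L \<Longrightarrow> y \<in> pts L \<Longrightarrow> x - y \<in> pts L"
  and pts_zero: "0 \<in> pts L"
  and pts_add: "x \<in> pts L \<Longrightarrow> y \<in> pts L \<Longrightarrow> x + y \<in> pts L"
  using zlattice by (auto simp: is_zlattice_def zbasis_def intro: group_closure.diff group_closure_add)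

end

context rat_space
begin

lemma scale_of_int_in_subgroup:
  assumes diff: "\<And>x y. x \<in> H \<Longrightarrow> y \<in> H \<Longrightarrow> x - y \<in> H" and x: "x \<in> H"
  shows "scale (of_int n) x \<in> H"
proof -
  have zero: "0 \<in> H" using diff[OF x x] by simp
  have add: "u + v \<in> H" if "u \<in> H" "v \<in> H" for u v
    using diff[OF that(1) diff[OF zero that(2)]] by simp
  have nat: "scale (of_nat k) x \<in> H" for k
    by (induction k) (use zero x add in \<open>auto simp: scale_left_distrib\<close>)
  show ?thesis
  proof (cases n)
    case (nonneg k) then show ?thesis using nat by simp
  next
    case (neg k)
    then have "scale (of_int n) x = 0 - scale (of_nat (Suc k)) x"
      by (metis diff_0 of_int_minus of_int_of_nat_eq scale_minus_left)
    then show ?thesis using diff[OF zero nat] by metis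
  qed
qed

lemma group_closure_subset_span: "group_closure B \<subseteq> span B"
proof
  fix x assume "x \<in> group_closure B"
  then show "x \<in> span B"
    by induction (auto intro: span_base span_diff span_zero)
qed

lemma span_group_closure: "span (group_closure B) = span B"
  using group_closure_subset_span[of B] span_mono[of B "group_closure B"]
  by (metis group_closure.base insertI2 span_minimal span_subspace subset_antisym subsetI subspace_span)

lemma group_closure_pair_eq:
  "group_closure {x, y} = {scale (of_int m) x + scale (of_int n) y | m n. True}"
proof -
  have "scale (of_int m) x + scale (of_int n) y \<in> group_closure {x, y}" for m n
    by (intro group_closure_add scale_of_int_in_subgroup)
       (auto intro: group_closure.base group_closure.diff)
  then show ?thesis using Defs.group_closure_pair[OF vector_space_axioms] by blast
qed

lemma group_closure_insert:
  assumes "x \<in> group_closure (insert b B)"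
  shows "\<exists>n y. y \<in> group_closure B \<and> x = scale (of_int n) b + y"
  using assms
proof induction
  case (base s)
  then show ?case
  proof (cases "s = b")
    case True
    then show ?thesis by (intro exI[of _ 1] exI[of _ 0]) simp
  next
    case False
    then show ?thesis using base by (intro exI[of _ 0] exI[of _ s]) (auto intro: group_closure.base)
  qed
next
  case (diff s t)
  then obtain m n y z where "y \<in> group_closure B" "s = scale (of_int m) b + y"
    "z \<in> group_closure B" "t = scale (of_int n) b + z" by blast
  then show ?case
    by (intro exI[of _ "m - n"] exI[of _ "y - z"])
       (auto simp: scale_left_diff_distrib intro: group_closure.diff)
qed

lemma group_closure_subset:
  assumes "B \<subseteq> H" "0 \<in> H" "\<And>x y. x \<in> H \<Longrightarrow> y \<in> H \<Longrightarrow> x - y \<in> H"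
  shows "group_closure B \<subseteq> H"
proof
  fix x assume "x \<in> group_closure B"
  then show "x \<in> H" by induction (use assms in auto)
qed

end

section \<open>Bases of subgroups of free abelian groups\<close>

text \<open>Division with remainder by the least positive member. The trivial subgroup yields
  \<open>d = 0\<close>, the value by which \<open>subgroup_has_zbasis\<close> recognises that a
  coordinate does not occur.\<close>

lemma int_subgroup_principal:
  fixes I :: "int set"
  assumes zero: "0 \<in> I" and diff: "\<And>x y. x \<in> I \<Longrightarrow> y \<in> I \<Longrightarrow> x - y \<in> I"
  obtains d where "d \<in> I" "\<And>x. x \<in> I \<Longrightarrow> d dvd x"
proof -
  have uminus: "- x \<in> I" if "x \<in> I" for x using diff[OF zero that] by simp
  have add: "x + y \<in> I" if "x \<in> I" "y \<in> I" for x y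
    using diff[OF that(1) uminus[OF that(2)]] by simp
  have nmul: "int k * x \<in> I" if "x \<in> I" for k x
    by (induction k) (use zero add that in \<open>auto simp: algebra_simps\<close>)
  have mul: "k * x \<in> I" if "x \<in> I" for k x
    using nmul[OF that, of "nat k"] uminus[OF nmul[OF that, of "nat (- k)"]] by (cases "k \<ge> 0") auto
  show thesis
  proof (cases "I \<subseteq> {0}")
    case True
    then show ?thesis using that[of 0] zero by auto
  next
    case False
    then obtain x0 where "x0 \<in> I" "x0 \<noteq> 0" by auto
    then have ex: "\<exists>k. k > 0 \<and> int k \<in> I"
      using uminus[of x0] by (intro exI[of _ "nat \<bar>x0\<bar>"]) (auto simp: abs_if)
    define d where "d = (LEAST k. k > 0 \<and> int k \<in> I)"
    have d: "d > 0" "int d \<in> I" using LeastI_ex[OF ex] by (auto simp: d_def)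
    have "int d dvd x" if "x \<in> I" for x
    proof -
      have "x - (x div int d) * int d \<in> I" using diff[OF that mul[OF d(2)]] .
      then have "x mod int d \<in> I" by (simp add: minus_div_mult_eq_mod)
      moreover have "0 \<le> x mod int d" "x mod int d < int d" using d(1) by simp_all
      ultimately have "x mod int d = 0"
        using not_less_Least[of "nat (x mod int d)" "\<lambda>k. k > 0 \<and> int k \<in> I", folded d_def]
        by (auto simp: nat_less_iff)
      then show ?thesis by presburger
    qed
    then show ?thesis using that d(2) by blast
  qed
qed

text \<open>This supplies the basis that \<open>is_zlattice\<close> demands of a saturation.
  Induction on \<open>B\<close>: the coordinates along \<open>b\<close> of the members of
  \<open>H\<close> form a principal ideal, and a lift \<open>h\<close> of its generator is joined to
  a basis of the members without that coordinate.\<close>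

lemma (in rat_space) subgroup_has_zbasis:
  assumes "finite B" "independent B" "H \<subseteq> group_closure B" "0 \<in> H"
    and "\<And>x y. x \<in> H \<Longrightarrow> y \<in> H \<Longrightarrow> x - y \<in> H"
  shows "\<exists>C. finite C \<and> independent C \<and> H = group_closure C"
  using assms
proof (induction B arbitrary: H rule: finite_induct)
  case empty
  have "group_closure {} \<subseteq> {0}" by (rule group_closure_subset) auto
  then have "H = group_closure {}" using empty by (auto simp: independent_empty)
  then show ?case by (intro exI[of _ "{}"]) (auto simp: independent_empty)
next
  case (insert b B)
  have b: "b \<notin> span B" and indB: "independent B"
    using insert.prems(1) insert.hyps(2) by (simp_all add: independent_insert)
  note diff = insert.prems(4)
  define I where "I = {n. \<exists>y\<in>group_closure B. scale (of_int n) b + y \<in> H}"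
  have "0 \<in> I" using insert.prems(3) by (auto simp: I_def intro!: bexI[of _ 0])
  moreover have "m - n \<in> I" if mn: "m \<in> I" "n \<in> I" for m n
  proof -
    obtain y z where yz: "y \<in> group_closure B" "scale (of_int m) b + y \<in> H"
      "z \<in> group_closure B" "scale (of_int n) b + z \<in> H" using mn by (auto simp: I_def)
    have "scale (of_int (m - n)) b + (y - z) = (scale (of_int m) b + y) - (scale (of_int n) b + z)"
      by (simp add: scale_left_diff_distrib)
    then show ?thesis using diff[OF yz(2,4)] group_closure.diff[OF yz(1,3)]
      by (metis (mono_tags, lifting) I_def mem_Collect_eq)
  qed
  ultimately obtain d where d: "d \<in> I" "\<And>n. n \<in> I \<Longrightarrow> d dvd n"
    using int_subgroup_principal by blast
  then obtain y0 where y0: "y0 \<in> group_closure B" "scale (of_int d) b + y0 \<in> H" by (auto simp: I_def)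
  define h where "h = scale (of_int d) b + y0"
  have "\<exists>C. finite C \<and> independent C \<and> H \<inter> group_closure B = group_closure C"
    by (rule insert.IH) (use indB insert.prems in \<open>auto intro: group_closure.diff\<close>)
  then obtain C where C: "finite C" "independent C" "H \<inter> group_closure B = group_closure C" by blast
  have dec: "\<exists>k y. y \<in> group_closure C \<and> x = scale (of_int k) h + y" if x: "x \<in> H" for x
  proof -
    obtain n y where y: "y \<in> group_closure B" "x = scale (of_int n) b + y"
      using group_closure_insert[of x b B] x insert.prems(2) by blast
    then have "n \<in> I" using x by (auto simp: I_def)
    then obtain k where k: "n = d * k" using d(2) by (meson dvdE)
    \<comment> \<open>The coordinates along \<open>b\<close> cancel: the left side lies in
      \<open>H\<close>, the right side in the group generated by \<open>B\<close>.\<close>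
    have e: "x - scale (of_int k) h = y - scale (of_int k) y0"
      by (simp add: y(2) k h_def scale_right_distrib mult.commute)
    have "scale (of_int k) h \<in> H" "scale (of_int k) y0 \<in> group_closure B"
      using scale_of_int_in_subgroup[of H h] scale_of_int_in_subgroup[of "group_closure B" y0] diff y0
      by (auto simp: h_def intro: group_closure.diff)
    then have "x - scale (of_int k) h \<in> group_closure C"
      using diff[OF x] e group_closure.diff[OF y(1)] C(3) by (metis IntI)
    then show ?thesis by (intro exI[of _ k] exI[of _ "x - scale (of_int k) h"]) simp
  qed
  show ?case
  proof (cases "d = 0")
    case True
    have "H \<subseteq> group_closure B"
    proof
      fix x assume x: "x \<in> H"
      obtain n y where y: "y \<in> group_closure B" "x = scale (of_int n) b + y"
        using group_closure_insert[of x b B] x insert.prems(2) by blast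
      then have "n \<in> I" using x by (auto simp: I_def)
      then have "n = 0" using d(2) True by auto
      then show "x \<in> group_closure B" using y by simp
    qed
    then show ?thesis using C by (metis Int_absorb2)
  next
    case False
    have spanC: "span C \<subseteq> span B"
      using C(3) group_closure_subset_span[of B] span_group_closure[of C]
      by (metis inf_le2 order_trans span_minimal subspace_span)
    have "h \<notin> span B"
    proof
      assume "h \<in> span B"
      then have "h - y0 \<in> span B" using y0(1) group_closure_subset_span span_diff by blast
      then have "scale (of_int d) b \<in> span B" by (simp add: h_def)
      from span_scale[OF this, of "inverse (of_int d)"] show False using b False by simp
    qed
    then have "independent (insert h C)" using spanC C(2) by (intro independent_insertI) auto
    moreover have "H = group_closure (insert h C)"
    proof
      show "H \<subseteq> group_closure (insert h C)"
      proof
        fix x assume "x \<in> H"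
        then obtain k y where y: "y \<in> group_closure C" "x = scale (of_int k) h + y" using dec by blast
        have "group_closure C \<subseteq> group_closure (insert h C)"
          by (rule group_closure_subset) (auto intro: group_closure.base group_closure.diff)
        moreover have "scale (of_int k) h \<in> group_closure (insert h C)"
          by (rule scale_of_int_in_subgroup) (auto intro: group_closure.base group_closure.diff)
        ultimately show "x \<in> group_closure (insert h C)" using y group_closure_add by blast
      qed
      have "C \<subseteq> H" using C(3) by (auto intro: group_closure.base)
      then show "group_closure (insert h C) \<subseteq> H"
        using y0(2) insert.prems by (intro group_closure_subset) (auto simp: h_def)
    qed
    ultimately show ?thesis using C(1) by (intro exI[of _ "insert h C"]) simp
  qed
qed

section \<open>Gram determinants, saturation and copies of binary lattices\<close>

context zlattice
begin

text \<open>This is -4 times the Gram determinant, defined for any two vectors; its nonvanishing is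
  the working criterion for independence.\<close>

definition gdisc :: "'a \<Rightarrow> 'a \<Rightarrow> rat" where
  "gdisc x y = (2 * bil L x y)\<^sup>2 - 4 * bil L x x * bil L y y"

lemma gdisc_linear_change:
  "gdisc (smul L \<alpha> x + smul L \<beta> y) (smul L \<gamma> x + smul L \<delta> y) = (\<alpha> * \<delta> - \<beta> * \<gamma>)\<^sup>2 * gdisc x y"
  unfolding gdisc_def bil_simps bil_sym[of y x] by (simp add: algebra_simps power2_eq_square)

lemma bil_self_comb:
  "bil L (smul L \<alpha> x + smul L \<beta> y) (smul L \<alpha> x + smul L \<beta> y) =
     \<alpha>\<^sup>2 * bil L x x + \<alpha> * \<beta> * (2 * bil L x y) + \<beta>\<^sup>2 * bil L y y"
  unfolding bil_simps bil_sym[of y x] by (simp add: algebra_simps power2_eq_square)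

lemma independent_if_gdisc_nonzero:
  assumes "gdisc x y \<noteq> 0"
  shows "x \<noteq> y" "V.independent {x, y}"
proof -
  show xy: "x \<noteq> y" using assms by (auto simp: gdisc_def power2_eq_square)
  have "bil L z 0 = 0" for z using bil_smul_right[of z 0 0] by simp
  then have "y \<noteq> 0" using assms by (auto simp: gdisc_def)
  moreover have "x \<notin> V.span {y}"
  proof
    assume "x \<in> V.span {y}"
    then obtain k where "x = smul L k y" by (auto simp: V.span_singleton)
    then show False using assms by (auto simp: gdisc_def bil_simps power2_eq_square)
  qed
  ultimately show "V.independent {x, y}"
    by (intro V.independent_insertI) (auto simp: V.independent_empty V.dependent_single)
qed

lemma span_pair: "V.span {x, y} = {smul L \<alpha> x + smul L \<beta> y | \<alpha> \<beta>. True}"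
proof -
  have "\<exists>\<alpha> \<beta>. v = smul L \<alpha> x + smul L \<beta> y" if v: "v \<in> V.span {x, y}" for v
  proof -
    obtain k where "v - smul L k x \<in> V.span {y}" using v V.span_breakdown_eq[of v x "{y}"] by blast
    then obtain m where "v - smul L k x = smul L m y" by (auto simp: V.span_singleton)
    then show ?thesis by (metis add.commute diff_add_cancel)
  qed
  moreover have "smul L \<alpha> x + smul L \<beta> y \<in> V.span {x, y}" for \<alpha> \<beta>
    by (intro V.span_add V.span_scale V.span_base) auto
  ultimately show ?thesis by blast
qed

lemma smul_of_int_pts: "x \<in> pts L \<Longrightarrow> smul L (of_int n) x \<in> pts L"
  by (rule V.scale_of_int_in_subgroup) (auto intro: pts_diff)

text \<open>The rational plane through \<open>G\<close> and \<open>H\<close>, cut with the lattice,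
  is saturated by construction and has a basis by \<open>subgroup_has_zbasis\<close>. It is the
  candidate for the primitive binary sublattice sought.\<close>

lemma saturation_of_pair:
  assumes GH: "G \<in> pts L" "H \<in> pts L" and disc: "gdisc G H \<noteq> 0"
  obtains M where "primitive_sublattice M L" "lat_rank M = 2" "bil M = bil L"
    "pts M = V.span {G, H} \<inter> pts L"
proof -
  define M where "M = L\<lparr>pts := V.span {G, H} \<inter> pts L\<rparr>"
  obtain bs where bs: "finite bs" "V.independent bs" "pts L = group_closure bs"
    using zlattice by (auto simp: is_zlattice_def zbasis_def)
  have "\<exists>C. finite C \<and> V.independent C \<and> pts M = group_closure C"
    by (rule V.subgroup_has_zbasis[OF bs(1,2)])
       (use bs(3) in \<open>auto simp: M_def intro: V.span_zero V.span_diff pts_diff group_closure.diff\<close>)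
  then have "is_zlattice M"
    using zlattice by (auto simp: is_zlattice_def zbasis_def M_def)
  moreover have span: "V.span (pts M) = V.span {G, H}"
  proof
    show "V.span (pts M) \<subseteq> V.span {G, H}"
      by (rule V.span_minimal) (auto simp: M_def)
    show "V.span {G, H} \<subseteq> V.span (pts M)"
      by (rule V.span_mono) (use GH in \<open>auto simp: M_def intro: V.span_base\<close>)
  qed
  ultimately have "primitive_sublattice M L"
    unfolding primitive_sublattice_def sublattice_def span by (simp add: M_def)
  moreover have "lat_rank M = 2"
    using V.dim_eq_card[of "{G, H}" "pts M"] span independent_if_gdisc_nonzero[OF disc]
    by (simp add: lat_rank_def M_def)
  ultimately show thesis using that by (simp add: M_def)
qed

lemma norm_ideal_subset:
  assumes "\<And>x. x \<in> pts L \<Longrightarrow> bil L x x \<in> int_multiples p"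
  shows "norm_ideal L \<subseteq> int_multiples p"
proof
  fix z assume "z \<in> norm_ideal L"
  then show "z \<in> int_multiples p" unfolding norm_ideal_def
  proof induction
    case (base s)
    moreover have "0 \<in> int_multiples p" by (auto simp: int_multiples_def intro!: exI[of _ 0])
    ultimately show ?case using assms by auto
  next
    case (diff s t)
    then obtain j k where "s = of_int (p * j)" "t = of_int (p * k)" by (auto simp: int_multiples_def)
    then have "s - t = of_int (p * (j - k))" by (simp add: algebra_simps)
    then show ?case unfolding int_multiples_def by blast
  qed
qed

lemma zbasis_pair_change:
  assumes basis: "zbasis L {x, y}" and disc: "gdisc x y \<noteq> 0" and det: "\<alpha> * \<delta> - \<beta> * \<gamma> = 1"
  defines "x' \<equiv> smul L (of_int \<alpha>) x + smul L (of_int \<beta>) y"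
    and "y' \<equiv> smul L (of_int \<gamma>) x + smul L (of_int \<delta>) y"
  shows "zbasis L {x', y'}" "gdisc x' y' = gdisc x y"
proof -
  have "(of_int (\<alpha> * \<delta> - \<beta> * \<gamma>) :: rat) = 1" using det by simp
  then have det': "(of_int \<alpha> * of_int \<delta> - of_int \<beta> * of_int \<gamma> :: rat) = 1" by simp
  show gd: "gdisc x' y' = gdisc x y"
    unfolding x'_def y'_def gdisc_linear_change det' by simp
  have "smul L (of_int \<delta>) x' - smul L (of_int \<beta>) y' = smul L (of_int (\<alpha> * \<delta> - \<beta> * \<gamma>)) x"
    "smul L (of_int \<alpha>) y' - smul L (of_int \<gamma>) x' = smul L (of_int (\<alpha> * \<delta> - \<beta> * \<gamma>)) y"
    by (simp_all add: x'_def y'_def V.scale_right_distrib V.scale_left_diff_distrib mult.commute)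
  then have inv: "x = smul L (of_int \<delta>) x' - smul L (of_int \<beta>) y'"
    "y = smul L (of_int \<alpha>) y' - smul L (of_int \<gamma>) x'"
    by (simp_all add: det)
  have scl: "smul L (of_int k) u \<in> group_closure S" if "u \<in> group_closure S" for k u S
    by (rule V.scale_of_int_in_subgroup) (use that in \<open>auto intro: group_closure.diff\<close>)
  have "group_closure {x', y'} \<subseteq> group_closure {x, y}"
    by (rule V.group_closure_subset)
       (auto simp: x'_def y'_def intro!: group_closure_add scl group_closure.diff intro: group_closure.base)
  moreover have "x \<in> group_closure {x', y'}" "y \<in> group_closure {x', y'}"
    unfolding inv by (auto intro!: scl group_closure.diff intro: group_closure.base)
  then have "group_closure {x, y} \<subseteq> group_closure {x', y'}"
    by (intro V.group_closure_subset) (auto intro: group_closure.diff)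
  ultimately show "zbasis L {x', y'}"
    using basis independent_if_gdisc_nonzero[of x' y'] gd disc by (auto simp: zbasis_def)
qed

text \<open>The assignment of \<open>u\<close>, \<open>v\<close> to the basis extends linearly to
  the ambient space, and bilinearity carries the three equalities over to all pairs. Every copy of
  \<open>l\<close> found in an isolation is turned into a contradiction by this lemma.\<close>

lemma represents_if_gram_eq:
  fixes l :: "('b::ab_group_add) zlat"
  assumes l: "is_zlattice l" and basis: "zbasis l {x, y}"
    and uv: "u \<in> pts L" "v \<in> pts L" and xy: "x \<noteq> y"
    and gram: "bil L u u = bil l x x" "bil L u v = bil l x y" "bil L v v = bil l y y"
  shows "represents L l"
proof -
  interpret l: zlattice l by unfold_locales fact
  interpret P: vector_space_pair "smul l" "smul L" by unfold_locales
  obtain \<sigma> where lin: "Vector_Spaces.linear (smul l) (smul L) \<sigma>"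
    and \<sigma>: "\<forall>z\<in>{x, y}. \<sigma> z = (if z = x then u else v)"
    using P.linear_independent_extend[of "{x, y}" "\<lambda>z. if z = x then u else v"] basis
    by (auto simp: zbasis_def)
  have \<sigma>xy: "\<sigma> x = u" "\<sigma> y = v" using \<sigma> xy by auto
  have add: "\<sigma> (a + b) = \<sigma> a + \<sigma> b" and scale: "\<sigma> (smul l c a) = smul L c (\<sigma> a)" for a b c
    using lin by (simp_all add: Vector_Spaces.linear_iff)
  have pts: "\<exists>m n. z = smul l (of_int m) x + smul l (of_int n) y" if "z \<in> pts l" for z
    using that basis l.V.group_closure_pair_eq[of x y] by (auto simp: zbasis_def)
  show ?thesis unfolding represents_def
  proof (intro exI[of _ \<sigma>] conjI ballI)
    fix z assume "z \<in> pts l"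
    then obtain m n where z: "z = smul l (of_int m) x + smul l (of_int n) y" using pts by blast
    show "\<sigma> z \<in> pts L"
      unfolding z add scale \<sigma>xy by (intro pts_add smul_of_int_pts uv)
    fix w assume "w \<in> pts l"
    then obtain m' n' where w: "w = smul l (of_int m') x + smul l (of_int n') y" using pts by blast
    show "bil L (\<sigma> z) (\<sigma> w) = bil l z w"
      unfolding z w add scale \<sigma>xy bil_simps l.bil_simps bil_sym[of v u] l.bil_sym[of y x] gram ..
  qed (rule add)
qed

section \<open>The sublattice spanned by \<open>g\<close> and \<open>p h\<close>, and its image in
  an isolation\<close>

text \<open>The multiples of \<open>h\<close> by \<open>0, ..., p - 1\<close> meet every coset, so
  there are finitely many cosets; those of \<open>h\<close> and \<open>0\<close> differ, so there
  are at least two.\<close>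

lemma proper_sublattice_smul:
  assumes basis: "zbasis L {g, h}" and disc: "gdisc g h \<noteq> 0" and rank: "lat_rank L = 2" and p: "p > 1"
  shows "proper_sublattice (L\<lparr>pts := group_closure {g, smul L (of_int p) h}\<rparr>) L"
proof -
  define h' where "h' = smul L (of_int p) h"
  define K where "K = L\<lparr>pts := group_closure {g, h'}\<rparr>"
  have ptsL: "pts L = {smul L (of_int m) g + smul L (of_int n) h | m n. True}"
    using basis V.group_closure_pair_eq[of g h] by (auto simp: zbasis_def)
  have ptsK: "pts K = {smul L (of_int m) g + smul L (of_int (p * n)) h | m n. True}"
    using V.group_closure_pair_eq[of g h'] by (simp add: K_def h'_def mult.commute)
  have sub: "pts K \<subseteq> pts L" unfolding ptsL ptsK by blast
  have "gdisc g h' = of_int p ^ 2 * gdisc g h"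
    using gdisc_linear_change[of 1 g 0 h 0 "of_int p"] by (simp add: h'_def)
  then have disc': "gdisc g h' \<noteq> 0" using disc p by simp
  note ind = independent_if_gdisc_nonzero[OF disc']
  have "zbasis K {g, h'}" using ind by (simp add: zbasis_def K_def)
  then have latK: "is_zlattice K"
    using zlattice sub by (auto simp: is_zlattice_def K_def)
  have "V.span {g, h'} = V.span (pts K)" by (simp add: K_def V.span_group_closure)
  then have "V.dim (pts K) = 2"
    using V.dim_eq_card[of "{g, h'}" "pts K"] ind by simp
  then have rankK: "lat_rank K = 2" by (simp add: lat_rank_def K_def)
  define coset where "coset x = (+) x ` pts K" for x
  have coset_eq: "coset (x + k) = coset x" if k: "k \<in> pts K" for x k
  proof -
    interpret K: zlattice K by unfold_locales fact
    have "x + k + z \<in> coset x" if "z \<in> pts K" for z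
      using K.pts_add[OF k that] by (auto simp: coset_def add.assoc)
    moreover have "x + z \<in> coset (x + k)" if "z \<in> pts K" for z
      using K.pts_diff[OF that k] unfolding coset_def by (intro image_eqI[of _ _ "z - k"]) simp_all
    ultimately show ?thesis by (auto simp: coset_def)
  qed
  have "coset x \<in> (\<lambda>i. coset (smul L (of_int i) h)) ` {0..<p}" if x: "x \<in> pts L" for x
  proof -
    obtain m n where mn: "x = smul L (of_int m) g + smul L (of_int n) h" using x ptsL by blast
    have "smul L (of_int n) h = smul L (of_int (n mod p)) h + smul L (of_int (p * (n div p))) h"
      by (metis V.scale_left_distrib mod_mult_div_eq of_int_add)
    then have "x = smul L (of_int (n mod p)) h + (smul L (of_int m) g + smul L (of_int (p * (n div p))) h)"
      by (simp only: mn add_ac)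
    moreover have "smul L (of_int m) g + smul L (of_int (p * (n div p))) h \<in> pts K"
      unfolding ptsK by blast
    ultimately have "coset x = coset (smul L (of_int (n mod p)) h)" using coset_eq by metis
    then show ?thesis using p by (intro image_eqI[of _ _ "n mod p"]) auto
  qed
  then have "coset ` pts L \<subseteq> (\<lambda>i. coset (smul L (of_int i) h)) ` {0..<p}" by blast
  \<comment> \<open>Finiteness has to come first, since \<open>card\<close> is 0 on infinite
    sets.\<close>
  then have fin: "finite (coset ` pts L)" by (rule finite_subset) simp
  have h: "h \<in> pts L" "0 \<in> pts L" using basis pts_zero by (auto simp: zbasis_def intro: group_closure.base)
  have "coset h \<noteq> coset 0"
  proof
    have "0 \<in> pts K" by (simp add: K_def)
    then have "h \<in> coset h" by (auto simp: coset_def intro: image_eqI[of _ _ 0])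
    moreover assume "coset h = coset 0"
    ultimately have "h \<in> pts K" by (auto simp: coset_def)
    then obtain m n where "h = smul L (of_int m) g + smul L (of_int (p * n)) h" using ptsK by blast
    moreover have "smul L (of_int m) g + smul L (of_int (p * n) - 1) h =
        smul L (of_int m) g + smul L (of_int (p * n)) h - h"
      by (simp add: V.scale_left_diff_distrib)
    ultimately have "smul L (of_int m) g + smul L (of_int (p * n) - 1) h = 0"
      by (metis diff_self)
    \<comment> \<open>Paired with \<open>g\<close>, the vanishing combination contributes the square
      of its coefficient of \<open>h\<close>; so this coefficient is 0 and
      \<open>p * n = 1\<close>.\<close>
    moreover have "gdisc g (smul L (of_int m) g + smul L (of_int (p * n) - 1) h)
        = (of_int (p * n) - 1)\<^sup>2 * gdisc g h"
      using gdisc_linear_change[of 1 g 0 h "of_int m" "of_int (p * n) - 1"] by simp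
    moreover have "gdisc g 0 = 0" using bil_smul_right[of _ 0 0] by (simp add: gdisc_def)
    ultimately have "(of_int (p * n - 1) :: rat) = 0" using disc by simp
    then have "p * n = 1" by linarith
    then show False using p by (simp add: zmult_eq_1_iff)
  qed
  then have "card {coset h, coset 0} = 2" by simp
  moreover have "card {coset h, coset 0} \<le> card (coset ` pts L)"
    by (rule card_mono[OF fin]) (use h in auto)
  ultimately have "lat_index L K > 1" by (simp add: lat_index_def coset_def)
  then show ?thesis
    using latK sub rankK rank unfolding K_def h'_def proper_sublattice_def sublattice_def by simp
qed

text \<open>\<open>G\<close> and \<open>H\<close> are the images of \<open>g\<close> and
  \<open>p h\<close> under a representation of the proper sublattice spanned by these two
  vectors.\<close>

lemma isolation_pair:
  fixes L' :: "('b::ab_group_add) zlat"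
  assumes "isolation L' L" and "zbasis L {g, h}" "gdisc g h \<noteq> 0" "lat_rank L = 2" "p > 1"
  obtains G H where "G \<in> pts L'" "H \<in> pts L'" "bil L' G G = bil L g g"
    "bil L' G H = of_int p * bil L g h" "bil L' H H = of_int p ^ 2 * bil L h h"
proof -
  let ?K = "L\<lparr>pts := group_closure {g, smul L (of_int p) h}\<rparr>"
  have "represents L' ?K"
    using assms(1) proper_sublattice_smul[OF assms(2-5)] by (simp add: isolation_def)
  then obtain \<sigma> where \<sigma>: "\<forall>x\<in>pts ?K. \<sigma> x \<in> pts L'"
    "\<forall>x\<in>pts ?K. \<forall>y\<in>pts ?K. bil L' (\<sigma> x) (\<sigma> y) = bil L x y"
    unfolding represents_def by auto
  have mem: "g \<in> pts ?K" "smul L (of_int p) h \<in> pts ?K" by (auto intro: group_closure.base)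
  show thesis
    by (rule that[of "\<sigma> g" "\<sigma> (smul L (of_int p) h)"])
       (use \<sigma> mem in \<open>simp_all add: bil_simps power2_eq_square\<close>)
qed

section \<open>Dividing vectors by \<open>p\<close> inside the lattice\<close>

text \<open>With \<open>p\<close> dividing \<open>x\<close>, the part along \<open>G\<close> is
  itself in the lattice and can be subtracted. Then both \<open>y\<close> and \<open>p\<close> times
  \<open>H / p\<close> lie in the lattice, and Bezout for the coprime pair \<open>p\<close>,
  \<open>y\<close> gives \<open>H / p\<close>.\<close>

lemma smul_inverse_pts:
  assumes p: "prime (p::int)" and GH: "G \<in> pts L" "H \<in> pts L"
    and mem: "smul L (1 / of_int p) (smul L (of_int x) G + smul L (of_int y) H) \<in> pts L"
    and xy: "p dvd x" "\<not> p dvd y"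
  shows "smul L (1 / of_int p) H \<in> pts L"
proof -
  have p0: "p \<noteq> 0" using p by auto
  obtain x' where x': "x = p * x'" using xy(1) by blast
  define H' where "H' = smul L (1 / of_int p) H"
  have "smul L (1 / of_int p) (smul L (of_int x) G + smul L (of_int y) H)
      = smul L (of_int x') G + smul L (of_int y) H'"
    using p0 by (simp add: x' V.scale_right_distrib H'_def)
  then have "smul L (of_int x') G + smul L (of_int y) H' \<in> pts L" using mem by simp
  from pts_diff[OF this smul_of_int_pts[OF GH(1), of x']]
  have yH: "smul L (of_int y) H' \<in> pts L" by simp
  have pH: "smul L (of_int p) H' \<in> pts L" using p0 GH(2) by (simp add: H'_def)
  have "coprime p y" using p xy(2) by (simp add: prime_imp_coprime)
  then obtain a b where "a * p + b * y = 1" using bezout_int[of p y] by auto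
  then have "H' = smul L (of_int (a * p + b * y)) H'" by simp
  also have "\<dots> = smul L (of_int a) (smul L (of_int p) H') + smul L (of_int b) (smul L (of_int y) H')"
    by (simp add: V.scale_left_distrib)
  finally have "H' \<in> pts L"
    using pts_add[OF smul_of_int_pts[OF pH, of a] smul_of_int_pts[OF yH, of b]] by metis
  then show ?thesis by (simp add: H'_def)
qed

text \<open>By \<open>none\<close>, the saturation of \<open>G\<close>, \<open>H\<close> contains a
  vector of norm prime to \<open>p\<close>. After multiplication by an integer prime to
  \<open>p\<close>, some power of \<open>p\<close> takes it to an integral combination of
  \<open>G\<close> and \<open>H\<close>. The least such power provides \<open>w\<close>,
  \<open>x\<close> and \<open>y\<close>.\<close>

lemma divisible_comb:
  assumes p: "prime (p::int)" and int: "scale_ideal L \<subseteq> \<int>"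
    and none: "\<nexists>M. primitive_sublattice M L \<and> lat_rank M = 2 \<and> norm_ideal M \<subseteq> int_multiples p"
    and GH: "G \<in> pts L" "H \<in> pts L" and disc: "gdisc G H \<noteq> 0"
    and dvd: "\<And>x y. bil L (smul L (of_int x) G + smul L (of_int y) H)
      (smul L (of_int x) G + smul L (of_int y) H) \<in> int_multiples p"
  obtains x y n w where "\<not> (p dvd x \<and> p dvd y)" "\<not> p dvd n"
    "bil L (smul L (of_int x) G + smul L (of_int y) H) (smul L (of_int x) G + smul L (of_int y) H)
      = of_int (p ^ (2 * w) * n)"
    "smul L (1 / of_int p) (smul L (of_int x) G + smul L (of_int y) H) \<in> pts L"
proof -
  have p0: "p \<noteq> 0" using p by auto
  define Q where "Q v = bil L v v" for v
  have Qs: "Q (smul L c v) = c\<^sup>2 * Q v" for c v by (simp add: Q_def bil_simps power2_eq_square)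
  define c where "c x y = smul L (of_int x) G + smul L (of_int y) H" for x y :: int
  obtain M where M: "primitive_sublattice M L" "lat_rank M = 2" "bil M = bil L"
    "pts M = V.span {G, H} \<inter> pts L" using saturation_of_pair[OF GH disc] .
  interpret M: zlattice M
    using M(1) by unfold_locales (auto simp: primitive_sublattice_def sublattice_def)
  have "\<not> norm_ideal M \<subseteq> int_multiples p" using none M by blast
  then obtain v0 where v0: "v0 \<in> pts M" "Q v0 \<notin> int_multiples p"
    using M.norm_ideal_subset M(3) by (auto simp: Q_def)
  obtain \<alpha> \<beta> where v0_eq: "v0 = smul L \<alpha> G + smul L \<beta> H"
    using v0(1) M(4) by (auto simp: span_pair)
  obtain a1 b1 where q1: "\<alpha> = of_int a1 / of_int b1" "b1 \<noteq> 0"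
    by (metis quotient_of_div quotient_of_denom_pos less_irrefl surj_pair)
  obtain a2 b2 where q2: "\<beta> = of_int a2 / of_int b2" "b2 \<noteq> 0"
    by (metis quotient_of_div quotient_of_denom_pos less_irrefl surj_pair)
  have Nv0: "smul L (of_int (b1 * b2)) v0 = c (a1 * b2) (a2 * b1)"
    using q1 q2 by (simp add: v0_eq c_def V.scale_right_distrib mult.commute)
  \<comment> \<open>The denominator is split into its \<open>p\<close>-part and the rest
    \<open>m\<close>. Only \<open>m\<close> is cleared, which keeps the norm prime to
    \<open>p\<close>.\<close>
  obtain k m where km: "b1 * b2 = p ^ k * m" "\<not> p dvd m"
    using multiplicity_decompose'[of "b1 * b2" p] q1 q2 p
    by (metis mult_eq_0_iff not_prime_unit)
  define v where "v = smul L (of_int m) v0"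
  have v: "v \<in> pts L" using v0(1) M(4) smul_of_int_pts by (simp add: v_def)
  have QZ: "\<exists>n. Q u = of_int n" if "u \<in> pts L" for u
  proof -
    have "Q u \<in> scale_ideal L" unfolding scale_ideal_def Q_def
      using that by (intro group_closure.base) auto
    then show ?thesis using int by (auto elim: Ints_cases)
  qed
  obtain n0 where n0: "Q v0 = of_int n0" using QZ v0(1) M(4) by blast
  define n where "n = m\<^sup>2 * n0"
  have Qv: "Q v = of_int n" by (simp add: v_def Qs n0 n_def)
  have "\<not> p dvd n0" using v0(2) n0 by (auto simp: int_multiples_def)
  then have n: "\<not> p dvd n" using km(2) p by (simp add: n_def prime_dvd_mult_iff prime_dvd_power_iff)
  have ex: "\<exists>w. \<exists>x y. smul L (of_int (p ^ w)) v = c x y"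
    using Nv0 km(1) by (intro exI[of _ k]) (auto simp: v_def)
  define w where "w = (LEAST w. \<exists>x y. smul L (of_int (p ^ w)) v = c x y)"
  obtain x y where xy: "smul L (of_int (p ^ w)) v = c x y"
    using LeastI_ex[OF ex] unfolding w_def by blast
  have Qc: "Q (c x y) = of_int (p ^ (2 * w) * n)"
    unfolding xy[symmetric] Qs Qv by (simp add: power_mult mult.commute)
  \<comment> \<open>For \<open>w = 0\<close> the vector \<open>v\<close> would be an integral
    combination of \<open>G\<close> and \<open>H\<close>, whose norm is a multiple of
    \<open>p\<close> by \<open>dvd\<close>.\<close>
  have "w \<noteq> 0"
  proof
    assume "w = 0"
    then have "(of_int n :: rat) \<in> int_multiples p" using Qc dvd[of x y] by (simp add: Q_def c_def)
    then show False using n by (auto simp: int_multiples_def simp flip: of_int_mult)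
  qed
  then obtain w' where w': "w = Suc w'" using not0_implies_Suc by blast
  have divp: "smul L (of_int (p ^ w')) v = smul L (1 / of_int p) (c x y)"
    unfolding xy[symmetric] using p0 by (simp add: w')
  then have "smul L (1 / of_int p) (c x y) \<in> pts L" using smul_of_int_pts[OF v] by metis
  \<comment> \<open>Common divisibility would make the exponent \<open>w'\<close> suffice, against
    the minimality of \<open>w\<close>.\<close>
  moreover have "\<not> (p dvd x \<and> p dvd y)"
  proof
    assume "p dvd x \<and> p dvd y"
    then obtain x' y' where "x = p * x'" "y = p * y'" by blast
    then have "smul L (1 / of_int p) (c x y) = c x' y'"
      using p0 by (simp add: c_def V.scale_right_distrib)
    then have "\<exists>x y. smul L (of_int (p ^ w')) v = c x y" using divp by auto
    then show False using not_less_Least[of w'] w' unfolding w_def[symmetric]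
      by (metis (mono_tags, lifting) lessI w_def)
  qed
  ultimately show thesis using that[of x y n w] n Qc by (simp add: c_def Q_def)
qed

end

section \<open>Valuations, and zeros of a form modulo a split prime\<close>

text \<open>The two sides of \<open>eq\<close> have valuations \<open>2 * w\<close> and that of
  \<open>s\<close>. This is the parity test; it is applied to \<open>s\<close> and to
  \<open>s * p\<close>.\<close>

lemma even_multiplicity_if_square_times_unit:
  fixes p :: int
  assumes p: "prime p" and n: "\<not> p dvd n" and m: "\<not> p dvd m" and eq: "p ^ (2 * w) * n = s * m"
  shows "even (multiplicity p s)"
proof -
  have pe: "prime_elem p" using p by auto
  have "n \<noteq> 0" "m \<noteq> 0" using n m by auto
  moreover from this have "s \<noteq> 0" using eq p by auto
  moreover have "multiplicity p (p ^ (2 * w) * n) = multiplicity p (s * m)" using eq by simp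
  ultimately have "2 * w = multiplicity p s"
    using p not_dvd_imp_multiplicity_0[OF n] not_dvd_imp_multiplicity_0[OF m]
      multiplicity_same_power[of p "2 * w"] prime_gt_1_int[OF p]
    by (simp add: prime_elem_multiplicity_mult_distrib[OF pe])
  then show ?thesis by presburger
qed

lemma kronecker_one_not_dvd:
  assumes "prime p" "kronecker D p = 1"
  shows "\<not> p dvd D"
  using assms by (auto simp: kronecker_def Legendre_def cong_0_iff split: if_splits)

text \<open>For odd \<open>p\<close>, a square root of \<open>D\<close> modulo \<open>p\<close>
  solves the quadratic congruence unless \<open>p\<close> divides \<open>a\<close>, when
  \<open>(1, 0)\<close> is a zero. The zeros used are \<open>(1, 0)\<close>, \<open>(0, 1)\<close>
  and \<open>(x, 1)\<close>, each of which visibly completes to determinant 1.\<close>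

lemma split_prime_isotropic:
  fixes a b c :: int
  assumes p: "prime p" and D: "D = b\<^sup>2 - 4 * a * c" and kron: "kronecker D p = 1"
  shows "\<exists>\<alpha> \<beta> \<gamma> \<delta>. \<alpha> * \<delta> - \<beta> * \<gamma> = 1 \<and> p dvd bqf_eval (a, b, c) \<alpha> \<beta>"
proof -
  consider "p dvd a" | "p dvd c" | x where "p dvd bqf_eval (a, b, c) x 1"
  proof (cases "p = 2")
    case True
    then have D8: "D mod 8 = 1 \<or> D mod 8 = 7" and "odd D"
      using kron by (auto simp: kronecker_def split: if_splits)
    then have "odd b" using D by auto
    then obtain k where k: "b = 2 * k + 1" by (elim oddE)
    \<comment> \<open>An odd square is 1 modulo 8, so \<open>D\<close> is 1 or 5 modulo 8; the value
      5, which an odd \<open>a * c\<close> would give, is excluded by \<open>D8\<close>.\<close>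
    have "even (k * (k + 1))" by simp
    then obtain j where "k * (k + 1) = 2 * j" by (elim evenE)
    then have "D = 8 * j + 1 - 4 * (a * c)"
      unfolding D k by (simp add: algebra_simps power2_eq_square)
    moreover obtain q where "a * c = q" by blast
    ultimately have "even (a * c)" using D8 by presburger
    then show ?thesis using that True by auto
  next
    case False
    then have "Legendre D p = 1" using kron by (simp add: kronecker_def)
    then have "QuadRes p D" by (simp add: Legendre_def split: if_splits)
    then obtain d where d: "p dvd d\<^sup>2 - D" by (auto simp: QuadRes_def cong_iff_dvd_diff)
    have "\<not> p dvd 2" using False p primes_dvd_imp_eq[of p 2] by auto
    show ?thesis
    proof (cases "p dvd a")
      case False
      have 4: "\<not> p dvd 4 * a"
        using False \<open>\<not> p dvd 2\<close> p prime_dvd_mult_iff[of p 2 2] by (simp add: prime_dvd_mult_iff)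
      have "\<not> p dvd 2 * a" using False \<open>\<not> p dvd 2\<close> p by (simp add: prime_dvd_mult_iff)
      then have "coprime p (2 * a)" using prime_imp_coprime[OF p] by blast
      then have "coprime (2 * a) p" by (rule coprime_imp_coprime) auto
      then obtain i where i: "[2 * a * i = 1] (mod p)" using cong_solve_coprime_int by blast
      \<comment> \<open>This is the root \<open>(d - b) / (2 a)\<close> modulo \<open>p\<close>,
        with \<open>i\<close> the inverse of \<open>2 * a\<close>.\<close>
      define x where "x = i * (d - b)"
      have "p dvd 2 * a * i - 1" using i by (simp add: cong_iff_dvd_diff)
      then have "p dvd (2 * a * i - 1) * (d - b)" by simp
      then have e: "p dvd 2 * a * x + b - d" by (simp add: x_def algebra_simps)
      have "4 * a * bqf_eval (a, b, c) x 1 =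
          (2 * a * x + b - d) * (2 * a * x + b + d) + (d\<^sup>2 - D)"
        unfolding D by (simp add: algebra_simps power2_eq_square)
      then have "p dvd 4 * a * bqf_eval (a, b, c) x 1" using e d by (metis dvd_add dvd_mult2)
      then have "p dvd bqf_eval (a, b, c) x 1" using 4 p prime_dvd_mult_iff by blast
      then show ?thesis by (rule that(3))
    qed (rule that(1))
  qed
  then show ?thesis
  proof cases
    case 1
    then show ?thesis by (intro exI[of _ 1] exI[of _ 0]) simp
  next
    case 2
    then show ?thesis
      by (intro exI[of _ 0] exI[of _ 1] exI[of _ "-1"]) (auto intro: exI[of _ 0])
  next
    case (3 x)
    then show ?thesis by (intro exI[of _ x] exI[of _ 1] exI[of _ "-1"] exI[of _ 0]) simp
  qed
qed

text \<open>The new basis vectors are \<open>(\<alpha>, \<beta>)\<close> and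
  \<open>(\<gamma>, \<delta>)\<close>; the coefficients on the right recur at every change of
  basis.\<close>

lemma bqf_eval_substitution:
  "bqf_eval (a, b, c) (\<alpha> * x + \<gamma> * y) (\<beta> * x + \<delta> * y) =
     bqf_eval (bqf_eval (a, b, c) \<alpha> \<beta>, 2 * a * \<alpha> * \<gamma> + b * (\<alpha> * \<delta> + \<beta> * \<gamma>) + 2 * c * \<beta> * \<delta>,
       bqf_eval (a, b, c) \<gamma> \<delta>) x y"
  by (simp add: algebra_simps power2_eq_square)

lemma disc_substitution:
  fixes a b c :: int
  shows "(2 * a * \<alpha> * \<gamma> + b * (\<alpha> * \<delta> + \<beta> * \<gamma>) + 2 * c * \<beta> * \<delta>)\<^sup>2
      - 4 * bqf_eval (a, b, c) \<alpha> \<beta> * bqf_eval (a, b, c) \<gamma> \<delta>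
    = (\<alpha> * \<delta> - \<beta> * \<gamma>)\<^sup>2 * (b\<^sup>2 - 4 * a * c)"
  by (simp add: algebra_simps power2_eq_square)

text \<open>One step of Hensel lifting. When the first vector is a zero modulo \<open>p\<close>, the
  middle coefficient \<open>b'\<close> is invertible modulo \<open>p\<close> because
  \<open>p\<close> does not divide \<open>D\<close>; adding a suitable multiple \<open>p * t\<close>
  of the second vector produces a zero modulo \<open>p\<^sup>2\<close>.\<close>

lemma split_prime_isotropic_square:
  fixes a b c :: int
  assumes p: "prime p" and D: "D = b\<^sup>2 - 4 * a * c" and kron: "kronecker D p = 1"
  shows "\<exists>\<alpha> \<beta> \<gamma> \<delta>. \<alpha> * \<delta> - \<beta> * \<gamma> = 1 \<and> p\<^sup>2 dvd bqf_eval (a, b, c) \<alpha> \<beta>"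
proof -
  obtain \<alpha> \<beta> \<gamma> \<delta> where det: "\<alpha> * \<delta> - \<beta> * \<gamma> = 1" and dvd: "p dvd bqf_eval (a, b, c) \<alpha> \<beta>"
    using split_prime_isotropic[OF assms] by blast
  define b' where "b' = 2 * a * \<alpha> * \<gamma> + b * (\<alpha> * \<delta> + \<beta> * \<gamma>) + 2 * c * \<beta> * \<delta>"
  define c' where "c' = bqf_eval (a, b, c) \<gamma> \<delta>"
  obtain a' where a': "bqf_eval (a, b, c) \<alpha> \<beta> = p * a'" using dvd by blast
  have "b'\<^sup>2 = D + 4 * (p * a') * c'"
    using disc_substitution[of a \<alpha> \<gamma> b \<delta> \<beta> c] unfolding det D a' b'_def c'_def by simp
  then have "\<not> p dvd b'"
    using kronecker_one_not_dvd[OF p kron] p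
    by (metis dvd_add_left_iff dvd_mult dvd_mult2 dvd_triv_left mult.assoc mult.left_commute power2_eq_square)
  then have "coprime b' p" using prime_imp_coprime[OF p] by (simp add: coprime_commute)
  then obtain i where "[b' * i = 1] (mod p)" using cong_solve_coprime_int by blast
  then have "p dvd (b' * i - 1) * a'" by (simp add: cong_iff_dvd_diff)
  \<comment> \<open>Chosen to solve \<open>a' + t * b' = 0\<close> modulo \<open>p\<close>, where
    \<open>i\<close> inverts \<open>b'\<close>.\<close>
  define t where "t = - i * a'"
  have "p dvd a' + t * b'"
  proof -
    have "a' + t * b' = - ((b' * i - 1) * a')" by (simp add: t_def algebra_simps)
    then show ?thesis using \<open>p dvd (b' * i - 1) * a'\<close> by (simp only: dvd_minus_iff)
  qed
  then obtain r where r: "a' + t * b' = p * r" by blast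
  have "bqf_eval (a, b, c) (\<alpha> * 1 + \<gamma> * (p * t)) (\<beta> * 1 + \<delta> * (p * t)) = bqf_eval (p * a', b', c') 1 (p * t)"
    unfolding bqf_eval_substitution a' b'_def c'_def ..
  also have "\<dots> = p * (a' + t * b') + p\<^sup>2 * (c' * t\<^sup>2)"
    by (simp add: algebra_simps power2_eq_square)
  also have "\<dots> = p\<^sup>2 * (r + c' * t\<^sup>2)" unfolding r by (simp add: algebra_simps power2_eq_square)
  finally have "p\<^sup>2 dvd bqf_eval (a, b, c) (\<alpha> + \<gamma> * (p * t)) (\<beta> + \<delta> * (p * t))" by simp
  moreover have "(\<alpha> + \<gamma> * (p * t)) * \<delta> - (\<beta> + \<delta> * (p * t)) * \<gamma> = 1"
    using det by (simp add: algebra_simps)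
  ultimately show ?thesis by blast
qed

section \<open>Ambiguous classes that represent a prime\<close>

text \<open>A substitution of determinant 1 is invertible, so it sends no nonzero vector to
  zero.\<close>

lemma prim_forms_equiv_pos:
  assumes f: "f \<in> prim_forms D" and det: "\<alpha> * \<delta> - \<beta> * \<gamma> = (1::int)" and xy: "(x, y) \<noteq> (0, 0)"
  shows "bqf_eval f (\<alpha> * x + \<gamma> * y) (\<beta> * x + \<delta> * y) > 0"
proof -
  have "\<delta> * (\<alpha> * x + \<gamma> * y) - \<gamma> * (\<beta> * x + \<delta> * y) = (\<alpha> * \<delta> - \<beta> * \<gamma>) * x"
    "\<alpha> * (\<beta> * x + \<delta> * y) - \<beta> * (\<alpha> * x + \<gamma> * y) = (\<alpha> * \<delta> - \<beta> * \<gamma>) * y"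
    by (simp_all add: algebra_simps)
  then have "x = \<delta> * (\<alpha> * x + \<gamma> * y) - \<gamma> * (\<beta> * x + \<delta> * y)"
    "y = \<alpha> * (\<beta> * x + \<delta> * y) - \<beta> * (\<alpha> * x + \<gamma> * y)"
    by (simp_all only: det mult_1_left)
  then have "(\<alpha> * x + \<gamma> * y, \<beta> * x + \<delta> * y) \<noteq> (0, 0)"
    using xy by (metis Pair_inject diff_self mult_zero_right)
  then show ?thesis using f by (cases f) (auto simp: prim_forms_def simp del: bqf_eval.simps)
qed

text \<open>
  The class represents \<open>p\<close>, so it contains \<open>p x\<^sup>2 \<plusminus> b x y + p m y\<^sup>2\<close>, whose composition with itself
  is \<open>p\<^sup>2 x\<^sup>2 \<plusminus> b x y + m y\<^sup>2\<close>. Ambiguity makes the latter principal, hence it represents 1.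
\<close>

lemma ambiguous_prime_square_represents_one:
  fixes p b m :: int
  assumes p: "prime p" and pb: "\<not> p dvd b" and D: "D = b\<^sup>2 - 4 * p\<^sup>2 * m"
    and C: "C \<in> carrier (form_class_group D)" and amb: "ambiguous D C" and rep: "p \<in> represented_ints C"
  obtains r t where "p\<^sup>2 * r\<^sup>2 + b * r * t + m * t\<^sup>2 = 1"
proof -
  have Cq: "C \<in> prim_forms D // proper_equiv D" using C by (simp add: form_class_group_def)
  have p0: "p > 0" using p by (simp add: prime_gt_0_int)
  obtain f x y where f: "f \<in> C" and pxy: "bqf_eval f x y = p" using rep by (auto simp: represented_ints_def)
  have fp: "f \<in> prim_forms D" using Cq f equiv_proper_equiv in_quotient_imp_subset by blast
  obtain f1 f2 f3 where f123: "f = (f1, f2, f3)" by (cases f)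
  have fD: "f2\<^sup>2 - 4 * f1 * f3 = D" using fp f123 by (simp add: prim_forms_def)
  \<comment> \<open>The square of a common divisor divides the value, which is the prime
    \<open>p\<close>.\<close>
  have "coprime x y"
  proof -
    define g where "g = gcd x y"
    obtain x' y' where xy': "x = g * x'" "y = g * y'" unfolding g_def by (meson dvdE gcd_dvd1 gcd_dvd2)
    have "bqf_eval f x y = g\<^sup>2 * bqf_eval f x' y'"
      unfolding f123 xy' by (simp add: algebra_simps power2_eq_square)
    then have "p = g * (g * bqf_eval f x' y')" using pxy by (simp add: power2_eq_square mult.assoc)
    then have "is_unit g \<or> is_unit (g * bqf_eval f x' y')"
      by (rule irreducibleD[OF prime_elem_imp_irreducible[OF prime_imp_prime_elem[OF p]]])
    then have "is_unit g" by (metis dvd_mult_left)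
    then show ?thesis by (simp add: g_def coprime_iff_gcd_eq_1)
  qed
  then obtain u0 v0 where uv0: "u0 * x + v0 * y = 1" using bezout_int[of x y] by auto
  \<comment> \<open>The middle coefficient of \<open>f\<close> in the basis \<open>(x, y)\<close>,
    \<open>(u, v)\<close>.\<close>
  define \<beta> where "\<beta> u v = 2 * f1 * x * u + f2 * (x * v + y * u) + 2 * f3 * y * v" for u v
  have disc: "(\<beta> u v)\<^sup>2 - 4 * p * bqf_eval f u v = D" if "x * v - y * u = 1" for u v
    using disc_substitution[of f1 x u f2 v y f3] that pxy fD unfolding \<beta>_def f123
    by (simp del: bqf_eval.simps)
  define \<beta>0 where "\<beta>0 = \<beta> (- v0) u0"
  have det0: "x * u0 - y * (- v0) = 1" using uv0 by (simp add: algebra_simps)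
  obtain g0 where g0: "\<beta>0\<^sup>2 - 4 * p * g0 = D" using disc[OF det0] unfolding \<beta>0_def by blast
  have "even (\<beta>0 - b)"
  proof -
    have "\<beta>0\<^sup>2 - b\<^sup>2 = 2 * (2 * p * g0 - 2 * p\<^sup>2 * m)" using g0 D by (simp add: algebra_simps)
    then have "even (\<beta>0\<^sup>2 - b\<^sup>2)" by simp
    then show ?thesis by simp
  qed
  then obtain j where j: "\<beta>0 = b + 2 * j" by (metis add_diff_cancel_left' diff_add_cancel evenE add.commute)
  have "4 * (j * (j + b)) = 4 * (p * (g0 - p * m))"
    using g0 D unfolding j by (simp add: algebra_simps power2_eq_square)
  then have "p dvd j * (j + b)" by simp
  then have "p dvd j \<or> p dvd j + b" using p prime_dvd_mult_iff by blast
  \<comment> \<open>The squares of \<open>\<beta>0\<close> and \<open>b\<close> agree modulo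
    \<open>4 * p\<close>, so the two agree modulo \<open>2 * p\<close> up to the sign
    \<epsilon>.\<close>
  then obtain \<epsilon> k where \<epsilon>: "\<epsilon> = 1 \<or> \<epsilon> = -1" and k: "\<beta>0 = \<epsilon> * b + 2 * p * k"
  proof
    assume "p dvd j"
    then obtain k where "j = p * k" by blast
    then show ?thesis using that[of 1 k] j by simp
  next
    assume "p dvd j + b"
    then obtain k where "j + b = p * k" by blast
    then show ?thesis using that[of "-1" k] j by (simp add: algebra_simps)
  qed
  \<comment> \<open>Subtracting \<open>k\<close> times the first basis vector from the second lowers
    the middle coefficient by \<open>2 * k * p\<close>, to exactly
    \<open>\<epsilon> * b\<close>.\<close>
  define u v where "u = - v0 - k * x" and "v = u0 - k * y"
  have det: "x * v - y * u = 1" using det0 by (simp add: u_def v_def algebra_simps)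
  have "\<beta> u v = \<beta>0 - 2 * k * bqf_eval f x y"
    unfolding \<beta>_def \<beta>0_def u_def v_def f123 by (simp add: algebra_simps power2_eq_square)
  then have \<beta>: "\<beta> u v = \<epsilon> * b" unfolding pxy k by simp
  have \<epsilon>2: "\<epsilon>\<^sup>2 = 1" using \<epsilon> by auto
  then have \<epsilon>b: "(\<epsilon> * b)\<^sup>2 = b\<^sup>2" by (simp add: power_mult_distrib)
  have "4 * p * bqf_eval f u v = 4 * p * (p * m)"
    using disc[OF det] D unfolding \<beta> \<epsilon>b by (auto simp: power2_eq_square algebra_simps)
  then have fuv: "bqf_eval f u v = p * m" using p0 by simp
  define P where "P = (p, \<epsilon> * b, p * m)"
  have "bqf_eval f (x * X + u * Y) (y * X + v * Y) =
      bqf_eval (bqf_eval f x y, \<beta> u v, bqf_eval f u v) X Y" for X Y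
    unfolding f123 \<beta>_def by (rule bqf_eval_substitution)
  then have Pf: "bqf_eval P X Y = bqf_eval f (x * X + u * Y) (y * X + v * Y)" for X Y
    unfolding pxy \<beta> fuv P_def by simp
  have Ppos: "bqf_eval P X Y > 0" if "(X, Y) \<noteq> (0, 0)" for X Y
    unfolding Pf by (rule prim_forms_equiv_pos[OF fp det that])
  have pb': "\<not> p dvd \<epsilon> * b" using \<epsilon> pb by auto
  then have cop: "coprime p (\<epsilon> * b)" using p prime_imp_coprime by blast
  have "gcd p (gcd (\<epsilon> * b) (p * m)) = 1"
    unfolding gcd.assoc[symmetric] using cop by simp
  moreover have "(\<epsilon> * b)\<^sup>2 - 4 * p * (p * m) = D"
    unfolding \<epsilon>b D by (simp add: power2_eq_square)
  ultimately have "P \<in> prim_forms D" using Ppos by (simp add: prim_forms_def P_def)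
  moreover have "properly_equivalent P f"
    unfolding properly_equivalent_def
    by (rule exI[of _ x], rule exI[of _ u], rule exI[of _ y], rule exI[of _ v])
       (use Pf det in \<open>simp add: mult.commute[of u y]\<close>)
  ultimately have "(P, f) \<in> proper_equiv D" using fp by (simp add: proper_equiv_def)
  then have "(f, P) \<in> proper_equiv D" using equiv_proper_equiv by (meson equivE symE)
  then have PC: "P \<in> C" by (rule in_quotient_imp_closed[OF equiv_proper_equiv Cq f])
  define F where "F = (p\<^sup>2, \<epsilon> * b, m)"
  have "bqf_eval F X Y > 0" if XY: "(X, Y) \<noteq> (0, 0)" for X Y
  proof -
    have "p * bqf_eval F X Y = bqf_eval P (p * X) Y"
      by (simp add: F_def P_def algebra_simps power2_eq_square)
    moreover have "bqf_eval P (p * X) Y > 0" using XY p0 by (intro Ppos) auto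
    ultimately show ?thesis using p0 by (metis zero_less_mult_pos)
  qed
  moreover have "gcd (p\<^sup>2) (gcd (\<epsilon> * b) m) = 1"
    unfolding gcd.assoc[symmetric] using cop by simp
  moreover have "(\<epsilon> * b)\<^sup>2 - 4 * p\<^sup>2 * m = D" unfolding \<epsilon>b D ..
  ultimately have "F \<in> prim_forms D" by (simp add: prim_forms_def F_def)
  \<comment> \<open>Composition of forms with a common middle coefficient: the bilinear expressions
    are \<open>x z - m y w\<close> and \<open>p (x w + y z) + \<epsilon> b y w\<close>.\<close>
  moreover have "direct_composition P P F"
    unfolding direct_composition_def
    by (rule exI[of _ 1], rule exI[of _ 0], rule exI[of _ 0], rule exI[of _ "- m"],
        rule exI[of _ 0], rule exI[of _ p], rule exI[of _ p], rule exI[of _ "\<epsilon> * b"])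
       (simp add: P_def F_def algebra_simps power2_eq_square)
  ultimately have "F \<in> C \<otimes>\<^bsub>form_class_group D\<^esub> C" using PC by (auto simp: form_class_group_def)
  then have "F \<in> \<one>\<^bsub>form_class_group D\<^esub>" using amb unfolding ambiguous_def by simp
  then have "properly_equivalent (principal_form D) F"
    by (simp add: form_class_group_def proper_equiv_def)
  then obtain \<alpha> \<gamma> where "bqf_eval (principal_form D) 1 0 = bqf_eval F \<alpha> \<gamma>"
    unfolding properly_equivalent_def by blast
  \<comment> \<open>The sign moves from the middle coefficient to the second variable.\<close>
  then have "p\<^sup>2 * \<alpha>\<^sup>2 + b * \<alpha> * (\<epsilon> * \<gamma>) + m * (\<epsilon> * \<gamma>)\<^sup>2 = 1"
    by (simp add: principal_form_def F_def power_mult_distrib \<epsilon>2 algebra_simps)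
  then show thesis by (rule that)
qed

section \<open>Binary lattices as multiples of integral forms\<close>

context zlattice
begin

text \<open>The doubled product appears because the norm ideal controls \<open>2 * bil L x y\<close>
  and not \<open>bil L x y\<close>. The predicate is also used for pairs inside an isolation, such
  as \<open>G\<close>, \<open>H\<close>.\<close>

definition gram_form :: "int \<Rightarrow> 'a \<Rightarrow> 'a \<Rightarrow> int \<Rightarrow> int \<Rightarrow> int \<Rightarrow> bool" where
  "gram_form s x y a b c \<longleftrightarrow>
     bil L x x = of_int (s * a) \<and> 2 * bil L x y = of_int (s * b) \<and> bil L y y = of_int (s * c)"

lemma gram_form_eval:
  assumes "gram_form s x y a b c"
  shows "bil L (smul L (of_int m) x + smul L (of_int n) y) (smul L (of_int m) x + smul L (of_int n) y)
    = of_int (s * bqf_eval (a, b, c) m n)"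
  using assms unfolding bil_self_comb gram_form_def
  by (simp add: algebra_simps)

lemma gdisc_gram_form:
  "gram_form s x y a b c \<Longrightarrow> gdisc x y = of_int (s\<^sup>2 * (b\<^sup>2 - 4 * a * c))"
  by (simp add: gram_form_def gdisc_def algebra_simps power2_eq_square)

lemma gram_form_change:
  assumes gf: "gram_form s x y a b c"
  shows "gram_form s (smul L (of_int \<alpha>) x + smul L (of_int \<beta>) y) (smul L (of_int \<gamma>) x + smul L (of_int \<delta>) y)
    (bqf_eval (a, b, c) \<alpha> \<beta>) (2 * a * \<alpha> * \<gamma> + b * (\<alpha> * \<delta> + \<beta> * \<gamma>) + 2 * c * \<beta> * \<delta>)
    (bqf_eval (a, b, c) \<gamma> \<delta>)"
proof -
  have "2 * bil L (smul L (of_int \<alpha>) x + smul L (of_int \<beta>) y) (smul L (of_int \<gamma>) x + smul L (of_int \<delta>) y)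
    = 2 * of_int (\<alpha> * \<gamma>) * bil L x x + of_int (\<alpha> * \<delta> + \<beta> * \<gamma>) * (2 * bil L x y)
      + 2 * of_int (\<beta> * \<delta>) * bil L y y"
    unfolding bil_simps bil_sym[of y x] by (simp add: algebra_simps)
  also have "\<dots> = of_int (s * (2 * a * \<alpha> * \<gamma> + b * (\<alpha> * \<delta> + \<beta> * \<gamma>) + 2 * c * \<beta> * \<delta>))"
    using gf unfolding gram_form_def by (simp add: algebra_simps)
  finally show ?thesis
    using gram_form_eval[OF gf] unfolding gram_form_def by blast
qed

lemma binary_zbasis:
  assumes "lat_rank L = 2"
  obtains x y where "x \<noteq> y" "zbasis L {x, y}"
proof -
  obtain bs where bs: "zbasis L bs" using zlattice by (auto simp: is_zlattice_def)
  then have "V.dim (pts L) = card bs"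
    by (intro V.dim_eq_card) (auto simp: zbasis_def V.span_group_closure)
  then have "card bs = 2" using assms by (simp add: lat_rank_def)
  then show thesis using that bs by (auto simp: card_2_iff)
qed

text \<open>Polarisation: \<open>2 * bil L x y\<close> is the norm of \<open>x + y\<close> minus the
  norms of \<open>x\<close> and \<open>y\<close>.\<close>

lemma gram_form_of_norm_ideal:
  assumes norm: "norm_ideal L = int_multiples s" and basis: "zbasis L {x, y}"
  obtains a b c where "gram_form s x y a b c"
proof -
  have xy: "x \<in> pts L" "y \<in> pts L" using basis by (auto simp: zbasis_def intro: group_closure.base)
  have Q: "bil L v v \<in> norm_ideal L" if "v \<in> pts L" for v
    unfolding norm_ideal_def using that by (intro group_closure.base) auto
  have "bil L (x + y) (x + y) - bil L x x - bil L y y \<in> norm_ideal L"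
    using Q[OF xy(1)] Q[OF xy(2)] Q[OF pts_add[OF xy]]
    unfolding norm_ideal_def by (intro group_closure.diff)
  moreover have "bil L (x + y) (x + y) - bil L x x - bil L y y = 2 * bil L x y"
    using bil_sym[of y x] by (simp add: bil_simps)
  ultimately have "2 * bil L x y \<in> int_multiples s" using norm by simp
  then show thesis
    using that Q[OF xy(1)] Q[OF xy(2)] unfolding norm int_multiples_def gram_form_def by auto
qed

text \<open>A common prime factor \<open>p\<close> would put all norms into the multiples of
  \<open>s * p\<close>, although \<open>s\<close> belongs to the norm ideal.\<close>

lemma gram_form_primitive:
  assumes norm: "norm_ideal L = int_multiples s" and s: "s > 0" and basis: "zbasis L {x, y}"
    and gf: "gram_form s x y a b c" and p: "prime p"
  shows "\<not> (p dvd a \<and> p dvd b \<and> p dvd c)"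
proof
  assume "p dvd a \<and> p dvd b \<and> p dvd c"
  then obtain a' b' c' where abc: "a = p * a'" "b = p * b'" "c = p * c'" by blast
  have "bil L z z \<in> int_multiples (s * p)" if z: "z \<in> pts L" for z
  proof -
    obtain m n where "z = smul L (of_int m) x + smul L (of_int n) y"
      using z basis V.group_closure_pair_eq[of x y] by (auto simp: zbasis_def)
    then have "bil L z z = of_int (s * bqf_eval (a, b, c) m n)" using gram_form_eval[OF gf] by simp
    also have "s * bqf_eval (a, b, c) m n = s * p * bqf_eval (a', b', c') m n"
      by (simp add: abc algebra_simps)
    finally show ?thesis unfolding int_multiples_def by blast
  qed
  then have "int_multiples s \<subseteq> int_multiples (s * p)" using norm_ideal_subset norm by blast
  moreover have "of_int (s * 1) \<in> int_multiples s" unfolding int_multiples_def by blast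
  ultimately obtain k where "(of_int (s * 1) :: rat) = of_int (s * p * k)"
    unfolding int_multiples_def by blast
  then have "s * 1 = s * (p * k)" by (simp only: of_int_eq_iff mult.assoc)
  then have "p * k = 1" using s by simp
  then show False using prime_gt_1_int[OF p] by (simp add: zmult_eq_1_iff)
qed

text \<open>The part common to both parities. By \<open>psa\<close> all norms on the span of
  \<open>G\<close> and \<open>H\<close> are multiples of \<open>p\<close>, so
  \<open>divisible_comb\<close> applies. If \<open>p\<close> divided \<open>x\<close>, then
  \<open>H / p\<close> would lie in \<open>L'\<close> and form with \<open>G\<close> a pair with the
  Gram matrix of \<open>g\<close>, \<open>h\<close>.\<close>

lemma isolation_comb:
  fixes L' :: "('b::ab_group_add) zlat"
  assumes iso: "isolation L' L" and rank: "lat_rank L = 2" and p: "prime p"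
    and none: "\<nexists>M. primitive_sublattice M L' \<and> lat_rank M = 2 \<and> norm_ideal M \<subseteq> int_multiples p"
    and basis: "zbasis L {g, h}" and gf: "gram_form s g h a b c"
    and disc: "gdisc g h \<noteq> 0" and psa: "p dvd s * a"
  obtains G H x y n w where "G \<in> pts L'" "H \<in> pts L'"
    "zlattice.gram_form L' s G H a (p * b) (p\<^sup>2 * c)"
    "\<not> p dvd x" "\<not> p dvd n" "p ^ (2 * w) * n = s * bqf_eval (a, p * b, p\<^sup>2 * c) x y"
    "smul L' (1 / of_int p) (smul L' (of_int x) G + smul L' (of_int y) H) \<in> pts L'"
proof -
  interpret L': zlattice L' using iso by unfold_locales (simp add: isolation_def)
  have p1: "p > 1" by (rule prime_gt_1_int[OF p])
  obtain G H where GH: "G \<in> pts L'" "H \<in> pts L'" and gram: "bil L' G G = bil L g g"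
    "bil L' G H = of_int p * bil L g h" "bil L' H H = of_int p ^ 2 * bil L h h"
    using isolation_pair[OF iso basis disc rank p1] .
  have gf': "L'.gram_form s G H a (p * b) (p\<^sup>2 * c)"
    using gf unfolding gram_form_def L'.gram_form_def gram by (simp add: algebra_simps)
  have "L'.gdisc G H = of_int p ^ 2 * gdisc g h"
    unfolding gdisc_def L'.gdisc_def gram by (simp add: algebra_simps power2_eq_square)
  then have disc': "L'.gdisc G H \<noteq> 0" using disc p1 by simp
  have "of_int (s * bqf_eval (a, p * b, p\<^sup>2 * c) x y) \<in> int_multiples p" for x y
  proof -
    have "s * bqf_eval (a, p * b, p\<^sup>2 * c) x y = (s * a) * x\<^sup>2 + p * (s * b * x * y + p * s * c * y\<^sup>2)"
      by (simp add: algebra_simps power2_eq_square)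
    then have "p dvd s * bqf_eval (a, p * b, p\<^sup>2 * c) x y" using psa by (simp del: bqf_eval.simps)
    then show ?thesis unfolding int_multiples_def by (metis (mono_tags, lifting) dvdE mem_Collect_eq)
  qed
  then have dvd: "bil L' (smul L' (of_int x) G + smul L' (of_int y) H)
      (smul L' (of_int x) G + smul L' (of_int y) H) \<in> int_multiples p" for x y
    unfolding L'.gram_form_eval[OF gf'] .
  have int: "scale_ideal L' \<subseteq> \<int>" using iso by (simp add: isolation_def)
  obtain x y n w where xy: "\<not> (p dvd x \<and> p dvd y)" and n: "\<not> p dvd n"
    and eq: "bil L' (smul L' (of_int x) G + smul L' (of_int y) H) (smul L' (of_int x) G + smul L' (of_int y) H)
      = of_int (p ^ (2 * w) * n)"
    and mem: "smul L' (1 / of_int p) (smul L' (of_int x) G + smul L' (of_int y) H) \<in> pts L'"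
    using L'.divisible_comb[OF p int none GH disc' dvd] .
  have "p ^ (2 * w) * n = s * bqf_eval (a, p * b, p\<^sup>2 * c) x y"
    using eq unfolding L'.gram_form_eval[OF gf'] of_int_eq_iff by simp
  moreover have "\<not> p dvd x"
  proof
    assume "p dvd x"
    then have "smul L' (1 / of_int p) H \<in> pts L'"
      using L'.smul_inverse_pts[OF p GH mem] xy by blast
    then have "represents L' L"
      using independent_if_gdisc_nonzero(1)[OF disc] p1 GH
      by (intro L'.represents_if_gram_eq[OF zlattice basis, of G "smul L' (1 / of_int p) H"])
         (simp_all add: L'.bil_simps gram power2_eq_square)
    then show False using iso by (simp add: isolation_def)
  qed
  ultimately show thesis using that[OF GH gf' _ n] mem by blast
qed

end

section \<open>Contradiction in each parity of the valuation of \<open>s\<close>\<close>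

theorem theorem3p4:
  fixes l :: "('a::ab_group_add) zlat" and L :: "('b::ab_group_add) zlat"
    and s D :: int
  assumes "is_zlattice l" and "lat_rank l = 2"
    and "irrecoverable l"
    and "s > 0" and "norm_ideal l = int_multiples s"
    and "lat_disc l = of_int (s\<^sup>2 * D)"
    and "isolation L l"
  shows "\<forall>p::int. prime p \<longrightarrow> kronecker D p = 1 \<longrightarrow>
    (\<exists>C\<in>carrier (form_class_group D). ambiguous D C \<and> p \<in> represented_ints C) \<longrightarrow>
    (\<exists>M. primitive_sublattice M L \<and> lat_rank M = 2 \<and> norm_ideal M \<subseteq> int_multiples p)"
proof (intro allI impI, rule ccontr)
  fix p :: int
  assume p: "prime p" and kron: "kronecker D p = 1"
    and "\<exists>C\<in>carrier (form_class_group D). ambiguous D C \<and> p \<in> represented_ints C"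
    and none: "\<nexists>M. primitive_sublattice M L \<and> lat_rank M = 2 \<and> norm_ideal M \<subseteq> int_multiples p"
  then obtain C where C: "C \<in> carrier (form_class_group D)" "ambiguous D C" "p \<in> represented_ints C"
    by blast
  interpret l: zlattice l by unfold_locales fact
  interpret L: zlattice L using assms(7) by unfold_locales (simp add: isolation_def)
  have p1: "p > 1" by (rule prime_gt_1_int[OF p])
  have pe: "prime_elem p" using p by auto
  have pD: "\<not> p dvd D" by (rule kronecker_one_not_dvd[OF p kron])
  obtain x y where xy: "x \<noteq> y" "zbasis l {x, y}" using l.binary_zbasis[OF assms(2)] .
  obtain a b c where gf: "l.gram_form s x y a b c" using l.gram_form_of_norm_ideal[OF assms(5) xy(2)] .
  have gd: "l.gdisc x y = of_int (s\<^sup>2 * D)"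
    using lat_disc_eq[OF assms(1) xy] assms(6) by (simp add: l.gdisc_def)
  then have "(of_int (s\<^sup>2 * D) :: rat) = of_int (s\<^sup>2 * (b\<^sup>2 - 4 * a * c))"
    using l.gdisc_gram_form[OF gf] by metis
  then have "s\<^sup>2 * D = s\<^sup>2 * (b\<^sup>2 - 4 * a * c)" by (simp only: of_int_eq_iff)
  then have D: "D = b\<^sup>2 - 4 * a * c" using assms(4) by simp
  have "D \<noteq> 0" using pD by auto
  then have gd0: "l.gdisc x y \<noteq> 0" using gd assms(4) by simp
  show False
  proof (cases "even (multiplicity p s)")
    case False
    then have "p dvd s" by (metis even_zero not_dvd_imp_multiplicity_0)
    have "\<exists>\<alpha> \<beta> \<gamma> \<delta>. \<alpha> * \<delta> - \<beta> * \<gamma> = 1 \<and> \<not> p dvd bqf_eval (a, b, c) \<alpha> \<beta>"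
    proof -
      \<comment> \<open>By primitivity one of the values \<open>a\<close>, \<open>c\<close>,
        \<open>a + b + c\<close> at \<open>(1, 0)\<close>, \<open>(0, 1)\<close>,
        \<open>(1, 1)\<close> is prime to \<open>p\<close>.\<close>
      consider "\<not> p dvd a" | "\<not> p dvd c" | "p dvd a" "p dvd c" "\<not> p dvd b"
        using l.gram_form_primitive[OF assms(5,4) xy(2) gf p] by blast
      then show ?thesis
      proof cases
        case 1
        then show ?thesis by (intro exI[of _ 1] exI[of _ 0]) simp
      next
        case 2
        then show ?thesis by (intro exI[of _ 0] exI[of _ 1] exI[of _ "-1"]) simp
      next
        case 3
        then have abc: "\<not> p dvd a + b + c" by (simp add: dvd_add_left_iff dvd_add_right_iff)
        show ?thesis
          by (rule exI[of _ 1], rule exI[of _ 1], rule exI[of _ 0], rule exI[of _ 1]) (use abc in simp)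
      qed
    qed
    then obtain \<alpha> \<beta> \<gamma> \<delta> where det: "\<alpha> * \<delta> - \<beta> * \<gamma> = 1" and pa: "\<not> p dvd bqf_eval (a, b, c) \<alpha> \<beta>"
      by blast
    note basis' = l.zbasis_pair_change[OF xy(2) gd0 det]
    have gd0': "l.gdisc (smul l (of_int \<alpha>) x + smul l (of_int \<beta>) y)
        (smul l (of_int \<gamma>) x + smul l (of_int \<delta>) y) \<noteq> 0" using basis'(2) gd0 by simp
    obtain a' b' c' where a': "\<not> p dvd a'" and gf': "l.gram_form s
        (smul l (of_int \<alpha>) x + smul l (of_int \<beta>) y) (smul l (of_int \<gamma>) x + smul l (of_int \<delta>) y) a' b' c'"
      using l.gram_form_change[OF gf] pa by blast
    have "p dvd s * a'" using \<open>p dvd s\<close> by simp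
    then obtain m n w k where m: "\<not> p dvd m" "\<not> p dvd n"
      and eq: "p ^ (2 * w) * n = s * bqf_eval (a', p * b', p\<^sup>2 * c') m k"
      using l.isolation_comb[OF assms(7,2) p none basis'(1) gf' gd0'] by metis
    \<comment> \<open>Modulo \<open>p\<close> only \<open>a' * m\<^sup>2\<close> survives, so the
      value is prime to \<open>p\<close> and \<open>eq\<close> forces the valuation of
      \<open>s\<close> to be even.\<close>
    have "bqf_eval (a', p * b', p\<^sup>2 * c') m k = a' * m\<^sup>2 + p * (b' * m * k + p * c' * k\<^sup>2)"
      by (simp add: algebra_simps power2_eq_square)
    moreover have "\<not> p dvd a' * m\<^sup>2" using a' m p by (simp add: prime_dvd_mult_iff prime_dvd_power_iff)
    ultimately have "\<not> p dvd bqf_eval (a', p * b', p\<^sup>2 * c') m k"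
      by (metis dvd_add_left_iff dvd_triv_left)
    then show False using even_multiplicity_if_square_times_unit[OF p m(2) _ eq] False by blast
  next
    case True
    obtain \<alpha> \<beta> \<gamma> \<delta> where det: "\<alpha> * \<delta> - \<beta> * \<gamma> = 1" and pa: "p\<^sup>2 dvd bqf_eval (a, b, c) \<alpha> \<beta>"
      using split_prime_isotropic_square[OF p D kron] by blast
    define e f where "e = smul l (of_int \<alpha>) x + smul l (of_int \<beta>) y"
      and "f = smul l (of_int \<gamma>) x + smul l (of_int \<delta>) y"
    have basis': "zbasis l {e, f}" and gd': "l.gdisc e f = l.gdisc x y"
      unfolding e_def f_def by (rule l.zbasis_pair_change[OF xy(2) gd0 det])+
    have gd0': "l.gdisc e f \<noteq> 0" using gd' gd0 by simp
    obtain A b' c' where gf': "l.gram_form s e f (p\<^sup>2 * A) b' c'"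
      using l.gram_form_change[OF gf, of \<alpha> \<beta> \<gamma> \<delta>] pa unfolding e_def f_def by (metis dvdE)
    have "(of_int (s\<^sup>2 * D) :: rat) = of_int (s\<^sup>2 * (b'\<^sup>2 - 4 * (p\<^sup>2 * A) * c'))"
      using l.gdisc_gram_form[OF gf'] gd gd' by metis
    then have "s\<^sup>2 * D = s\<^sup>2 * (b'\<^sup>2 - 4 * (p\<^sup>2 * A) * c')" by (simp only: of_int_eq_iff)
    then have D': "D = b'\<^sup>2 - 4 * p\<^sup>2 * (A * c')" using assms(4) by simp
    have pb: "\<not> p dvd b'"
    proof
      assume "p dvd b'"
      then have "p dvd D" unfolding D' power2_eq_square by (intro dvd_diff) (auto intro: dvd_mult dvd_mult2)
      then show False using pD by simp
    qed
    have "p dvd s * (p\<^sup>2 * A)" by (simp add: power2_eq_square)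
    from l.isolation_comb[OF assms(7,2) p none basis' gf' gd0' this]
    obtain G H m k n w where GH: "G \<in> pts L" "H \<in> pts L"
      and gfL: "L.gram_form s G H (p\<^sup>2 * A) (p * b') (p\<^sup>2 * c')"
      and m: "\<not> p dvd m" "\<not> p dvd n"
      and eq: "p ^ (2 * w) * n = s * bqf_eval (p\<^sup>2 * A, p * b', p\<^sup>2 * c') m k"
      and mem: "smul L (1 / of_int p) (smul L (of_int m) G + smul L (of_int k) H) \<in> pts L" .
    have "p dvd k"
    proof (rule ccontr)
      assume k: "\<not> p dvd k"
      \<comment> \<open>Exactly one factor \<open>p\<close> splits off from the value, so
        \<open>s * p\<close> would have even valuation.\<close>
      have eq': "p ^ (2 * w) * n = (s * p) * (b' * m * k + p * (A * m\<^sup>2 + c' * k\<^sup>2))"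
        unfolding eq by (simp add: algebra_simps power2_eq_square)
      have "\<not> p dvd b' * m * k" using pb m k p by (simp add: prime_dvd_mult_iff)
      then have "\<not> p dvd b' * m * k + p * (A * m\<^sup>2 + c' * k\<^sup>2)"
        by (metis dvd_add_left_iff dvd_triv_left)
      then have "even (multiplicity p (s * p))"
        using even_multiplicity_if_square_times_unit[OF p m(2) _ eq'] by blast
      moreover have "multiplicity p (s * p) = Suc (multiplicity p s)"
        using assms(4) p1 multiplicity_same_power[of p 1]
        by (simp add: prime_elem_multiplicity_mult_distrib[OF pe])
      ultimately show False using True by simp
    qed
    define u where "u = smul L (1 / of_int p) G"
    \<comment> \<open>The roles of \<open>G\<close> and \<open>H\<close> are exchanged: now the
      coefficient of \<open>H\<close> is divisible by \<open>p\<close>.\<close>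
    have u: "u \<in> pts L"
      using L.smul_inverse_pts[OF p GH(2,1), of k m] mem \<open>p dvd k\<close> m(1)
      by (simp add: u_def add.commute)
    have gfu: "L.gram_form s u H A b' (p\<^sup>2 * c')"
      using gfL p1 unfolding L.gram_form_def u_def L.bil_simps by (simp add: field_simps power2_eq_square)
    obtain r t where rt: "p\<^sup>2 * r\<^sup>2 + b' * r * t + A * c' * t\<^sup>2 = 1"
      using ambiguous_prime_square_represents_one[OF p pb D' C] .
    \<comment> \<open>A composition substitution with the solution \<open>r\<close>,
      \<open>t\<close> inserted: by \<open>coeffs\<close> it turns
      \<open>(A, b', p\<^sup>2 * c')\<close> into \<open>(p\<^sup>2 * A, b', c')\<close> times the
      value of \<open>(p\<^sup>2, b', A * c')\<close> at \<open>r\<close>, \<open>t\<close>, which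
      is 1. Its determinant is the same value.\<close>
    define X Y where "X = smul L (of_int (p\<^sup>2 * r + b' * t)) u + smul L (of_int (- A * t)) H"
      and "Y = smul L (of_int (c' * t)) u + smul L (of_int r) H"
    have coeffs: "bqf_eval (A, b', p\<^sup>2 * c') (p\<^sup>2 * r + b' * t) (- A * t)
        = p\<^sup>2 * A * (p\<^sup>2 * r\<^sup>2 + b' * r * t + A * c' * t\<^sup>2)"
      "2 * A * (p\<^sup>2 * r + b' * t) * (c' * t) + b' * ((p\<^sup>2 * r + b' * t) * r + (- A * t) * (c' * t))
        + 2 * (p\<^sup>2 * c') * (- A * t) * r = b' * (p\<^sup>2 * r\<^sup>2 + b' * r * t + A * c' * t\<^sup>2)"
      "bqf_eval (A, b', p\<^sup>2 * c') (c' * t) r = c' * (p\<^sup>2 * r\<^sup>2 + b' * r * t + A * c' * t\<^sup>2)"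
      by (simp_all add: algebra_simps power2_eq_square)
    have "L.gram_form s X Y (p\<^sup>2 * A) b' c'"
      using L.gram_form_change[OF gfu, of "p\<^sup>2 * r + b' * t" "- A * t" "c' * t" r]
      unfolding coeffs rt X_def Y_def by simp
    moreover have "X \<in> pts L" "Y \<in> pts L"
      unfolding X_def Y_def by (intro L.pts_add L.smul_of_int_pts u GH(2))+
    ultimately have "represents L l"
      using gf' l.independent_if_gdisc_nonzero(1)[OF gd0']
      by (intro L.represents_if_gram_eq[OF assms(1) basis', of X Y])
         (auto simp: L.gram_form_def l.gram_form_def)
    then show False using assms(7) by (simp add: isolation_def)
  qed
qed

end
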